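(* Let $X_1, X_2, \dots$ be i.i.d. symmetric random vectors in $\mathbb{R}^3$. Suppose their common characteristic function $\phi(t) = \mathbb{E} e^{i\langle t, X_1\rangle}$ satisfies $$|\phi(t)| \leq \frac{C_0}{|t|}, \qquad t \in \mathbb{R}^3\setminus\{0\},$$ for some constant $C_0 > 0$. Assume that $$\mathsf{W}_2(X_1, \xi) \leq 10^{-38}\,C_1^{-9} \min\big\{(\mathbb{E}|X_1|^3)^{-6},1\big\},$$ where $C_1 = \max\{C_0,1\}$ and $\xi$ is a random vector uniform on the unit Euclidean sphere $\mathbb{S}^2$ in $\mathbb{R}^3$. Then for every $n \geq 3$ and every unit vector $a=(a_1,\dots,a_n)$ in $\mathbb{R}^n$ with $\|a\|_\infty \leq \frac{1}{\sqrt{2}}$, we have $$\mathbb{E}\left|\sum_{j=1}^n a_jX_j\right|^{-1} \leq \mathbb{E}\left|\frac{X_1+X_2}{\sqrt{2}}\right|^{-1}.$$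
   Context: $|\cdot|$ is the standard Euclidean norm and $\langle\cdot,\cdot\rangle$ the standard inner product. For $a\in\mathbb{R}^n$, $\|a\|_\infty=\max_{j\le n}|a_j|$; "unit vector" means $\sum_j a_j^2=1$. A random vector $X$ is symmetric if $-X$ has the same distribution as $X$. The Wasserstein distance $\mathsf{W}_2(X,Y)$ between (the distributions of) random vectors $X,Y$ in $\mathbb{R}^d$ is $\inf_{(X',Y')}(\mathbb{E}|X'-Y'|^2)^{1/2}$, the infimum being over all couplings, i.e. random vectors $(X',Y')$ in $\mathbb{R}^{2d}$ such that $X'$ has the distribution of $X$ and $Y'$ has the distribution of $Y$. *)

theory Defs
  imports "HOL-Probability.Probability"
begin

definition ennreal_sqrt :: "ennreal \<Rightarrow> ennreal" where
  "ennreal_sqrt x = (if x = \<top> then \<top> else ennreal (sqrt (enn2real x)))"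

definition couplings ::
    "'a::euclidean_space measure \<Rightarrow> 'a measure \<Rightarrow> ('a \<times> 'a) measure set" where
  "couplings \<mu> \<nu> = {\<pi>. sets \<pi> = sets (borel :: ('a \<times> 'a) measure) \<and>
     distr \<pi> borel fst = \<mu> \<and> distr \<pi> borel snd = \<nu>}"

text \<open>
  The infimum over all couplings of two random vectors depends only on their laws, and a coupling
  enters only through its joint law; so the distance is defined on laws. It takes the value
  \<open>\<infinity>\<close> when no coupling has finite cost.
\<close>
definition wasserstein2 :: "'a::euclidean_space measure \<Rightarrow> 'a measure \<Rightarrow> ennreal" where
  "wasserstein2 \<mu> \<nu> =
     (INF \<pi>\<in>couplings \<mu> \<nu>. ennreal_sqrt (\<integral>\<^sup>+ (x, y). ennreal ((norm (x - y))\<^sup>2) \<partial>\<pi>))"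

definition char_vec :: "'a::euclidean_space measure \<Rightarrow> 'a \<Rightarrow> complex" where
  "char_vec \<mu> t = (CLINT x|\<mu>. iexp (t \<bullet> x))"

text \<open>
  Normalised surface measure on the unit sphere: a Borel set \<open>A\<close> of the sphere gets the fraction
  of the volume of the unit ball that is taken up by the cone \<open>{r *\<^sub>R x | r x. 0 < r \<le> 1 \<and> x \<in> A}\<close>.
  Here \<open>sgn x = x /\<^sub>R norm x\<close>; the value \<open>sgn 0 = 0\<close> occurs with probability 0. The lemmas below
  show that this is a probability measure which is carried by the sphere and invariant under all
  orthogonal transformations.
\<close>
definition uniform_sphere :: "'a::euclidean_space measure" where
  "uniform_sphere = distr (uniform_measure lborel (cball 0 1)) borel sgn"

lemma emeasure_cball_0_1:
  "emeasure lborel (cball (0::'a::euclidean_space) 1) \<noteq> 0"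
  "emeasure lborel (cball (0::'a::euclidean_space) 1) \<noteq> \<infinity>"
proof -
  have "0 < measure lborel (cball (0::'a) 1)"
    by (rule content_cball_pos) simp
  then show "emeasure lborel (cball (0::'a) 1) \<noteq> 0"
    by (auto simp: measure_def)
  show "emeasure lborel (cball (0::'a) 1) \<noteq> \<infinity>"
    using emeasure_lborel_cball_finite[of "0::'a" 1] by simp
qed

lemma prob_space_uniform_sphere: "prob_space (uniform_sphere :: 'a::euclidean_space measure)"
  unfolding uniform_sphere_def
  by (intro prob_space.prob_space_distr prob_space_uniform_measure emeasure_cball_0_1) measurable

lemma AE_uniform_sphere: "AE x in (uniform_sphere :: 'a::euclidean_space measure). x \<in> sphere 0 1"
proof -
  have "AE x in lborel. x \<noteq> (0::'a)"
    by (rule AE_lborel_singleton)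
  then have "AE x in uniform_measure lborel (cball (0::'a) 1). x \<noteq> 0"
    by (intro AE_uniform_measureI) auto
  then have "AE x in uniform_measure lborel (cball (0::'a) 1). sgn x \<in> sphere 0 1"
    by eventually_elim (simp add: norm_sgn)
  then show ?thesis
    unfolding uniform_sphere_def by (subst AE_distr_iff) (auto simp: pred_def)
qed

lemma uniform_sphere_orthogonal_invariant:
  fixes T :: "real ^ 'n::{finite, wellorder} \<Rightarrow> real ^ 'n::_"
  assumes T: "orthogonal_transformation T"
  shows "distr uniform_sphere borel T = uniform_sphere"
proof -
  let ?U = "uniform_measure lborel (cball 0 1) :: (real ^ 'n::{finite, wellorder}) measure"
  have lin: "linear T" and nT: "\<And>x. norm (T x) = norm x"
    using T by (auto simp: orthogonal_transformation)
  have Tm [measurable]: "T \<in> borel_measurable borel"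
    using lin by (intro borel_measurable_continuous_onI linear_continuous_on)
      (simp add: linear_conv_bounded_linear)
  have inv: "emeasure lborel (T -` A) = emeasure lborel A"
    if A: "A \<in> sets borel" "A \<subseteq> cball 0 1" for A
  proof -
    have TA: "T -` A \<in> sets borel"
      using measurable_sets[OF Tm A(1)] by simp
    have fin: "B \<in> lmeasurable" if B: "B \<in> sets borel" "B \<subseteq> cball 0 1"
      for B :: "(real ^ 'n::{finite, wellorder}) set"
      using B by (intro bounded_set_imp_lmeasurable bounded_subset[OF bounded_cball]) auto
    have A': "A \<in> lmeasurable"
      using A by (rule fin)
    have "x \<in> cball 0 1" if "T x \<in> A" for x
      using subsetD[OF A(2) that] by (simp add: nT)
    then have TA': "T -` A \<in> lmeasurable"
      by (intro fin TA) blast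
    have "measure lebesgue (T ` (T -` A)) = measure lebesgue (T -` A)"
      by (rule measure_orthogonal_image[OF T TA'])
    then have "measure lebesgue A = measure lebesgue (T -` A)"
      using orthogonal_transformation_surj[OF T] by (simp add: surj_image_vimage_eq)
    then have "emeasure lebesgue A = emeasure lebesgue (T -` A)"
      by (simp only: emeasure_eq_measure2[OF A'] emeasure_eq_measure2[OF TA'])
    then show ?thesis
      using A TA by simp
  qed
  have U: "emeasure ?U (T -` A) = emeasure ?U A" if A: "A \<in> sets borel" for A
  proof -
    have eq: "cball 0 1 \<inter> T -` A = T -` (cball 0 1 \<inter> A)"
      by (auto simp: nT)
    have "T -` A \<in> sets borel"
      using measurable_sets[OF Tm A] by simp
    then show ?thesis
      using A inv[of "cball 0 1 \<inter> A"] by (simp add: eq)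
  qed
  have sg: "sgn (T x) = T (sgn x)" for x
    by (simp add: sgn_div_norm nT linear_scale[OF lin])
  show ?thesis
  proof (rule measure_eqI)
    fix A assume "A \<in> sets (distr uniform_sphere borel T)"
    then have A: "A \<in> sets borel" by simp
    have "emeasure (distr uniform_sphere borel T) A = emeasure ?U (sgn -` T -` A)"
      using A unfolding uniform_sphere_def
      by (simp add: emeasure_distr distr_distr vimage_comp comp_def)
    also have "sgn -` T -` A = T -` sgn -` A"
      by (auto simp: sg)
    also have "emeasure ?U \<dots> = emeasure ?U (sgn -` A)"
      using A by (intro U measurable_sets_borel) simp_all
    also have "\<dots> = emeasure uniform_sphere A"
      using A unfolding uniform_sphere_def by (simp add: emeasure_distr)
    finally show "emeasure (distr uniform_sphere borel T) A = emeasure uniform_sphere A" .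
  qed (simp add: uniform_sphere_def)
qed

end

theory Submission
  imports Defs "HOL-Real_Asymp.Real_Asymp"
begin

text \<open>
  For a unit vector \<open>\<theta>\<close> that is uniform on the sphere, \<open>cos (r * (\<theta> \<bullet> x))\<close> has mean
  \<open>sinc (r * norm x)\<close>, and \<open>sinc (r * norm x)\<close> integrates over \<open>r > 0\<close> to \<open>pi / (2 * norm x)\<close>. So the
  mean of \<open>1 / norm S\<close> is \<open>2 / pi\<close> times the integral of the characteristic function of \<open>S\<close> along
  random rays, and weighted AM-GM with weights \<open>(a j)\<^sup>2\<close> reduces the claim to Ball's inequality
  \<open>sqrt s * I s \<le> sqrt 2 * I 2\<close> for \<open>s \<ge> 2\<close>, where \<open>I s\<close> is the integral of \<open>\<bar>\<phi>\<bar> powr s\<close> along the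
  rays. If \<open>\<phi> = sinc\<close>, this follows for \<open>s \<le> 3\<close> from log-convexity of \<open>I\<close>
  and \<open>I 3 < exp (- 1 / 4) * I 2\<close>, and for \<open>s \<ge> 3\<close> from \<open>sinc r \<le> exp (- r\<^sup>2 / 6)\<close> on \<open>{0<..pi}\<close>
  and a bound on the tail. Besides log-convexity, which holds for every \<open>\<phi>\<close>, these are finitely many
  strict inequalities, so they survive the small perturbation of \<open>sinc\<close> that the Wasserstein bound
  permits.
\<close>

section \<open>The uniform distribution on the sphere\<close>

text \<open>The inequality \<open>sqrt s * I s \<le> sqrt 2 * I 2\<close> is an equality at
  \<open>s = 2\<close>, so near this exponent a perturbation of \<open>sinc\<close> has no room.
  Log-convexity avoids the difficulty because it is anchored at the value \<open>I 2\<close> of the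
  perturbed function itself; its gain \<open>exp (- (s - 2) / 4)\<close> outweighs the growth of
  \<open>sqrt s\<close>. The exponents are \<open>s = 1 / (a j)\<^sup>2\<close>: the bound on the
  coefficients says \<open>s \<ge> 2\<close>, and \<open>sqrt s\<close> is the Jacobian
  \<open>1 / \<bar>a j\<bar>\<close> of scaling a ray.

  The mean of \<open>1 / norm S\<close> may a priori be infinite. A triangular cut-off of the radius
  makes Fubini applicable, and its kernels increase, so monotone convergence in
  \<open>ennreal\<close> removes it. For \<open>n\<close> summands absolute values cost an
  inequality; for \<open>(X 1 + X 2) / sqrt 2\<close> the characteristic function is a square, and
  the formula is exact.

  The coupling controls \<open>\<phi> - sinc\<close> by a multiple of
  \<open>(norm t)\<^sup>2\<close>. This says nothing for large \<open>t\<close>, where the decay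
  \<open>C / norm t\<close> takes over. Near 0 the quadratic order is what allows the error to be
  absorbed into the Gaussian bound.\<close>

lemma emeasure_PiM_lborel_disc:
  assumes "finite A" "card A = 2" "0 < \<rho>"
  shows "emeasure (Pi\<^sub>M A (\<lambda>_. lborel)) {f \<in> space (Pi\<^sub>M A (\<lambda>_. lborel)). (\<Sum>i\<in>A. (f i)\<^sup>2) \<le> \<rho>} = ennreal (pi * \<rho>)"
proof -
  have "{f \<in> space (Pi\<^sub>M A (\<lambda>_. lborel)). (\<Sum>i\<in>A. (f i)\<^sup>2) \<le> \<rho>} =
    {f. sqrt (\<Sum>i\<in>A. (f i)\<^sup>2) \<le> sqrt \<rho>} \<inter> space (Pi\<^sub>M A (\<lambda>_. lborel))"
    by auto
  then show ?thesis
    using emeasure_cball_aux[of A "sqrt \<rho>"] assms by (simp add: eval_unit_ball_vol)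
qed

text \<open>Slices orthogonal to \<open>b\<close> at height \<open>y\<close> are discs of squared
  radius \<open>h y\<close>: the ball allows \<open>1 - y\<^sup>2\<close>, the cone allows
  \<open>y\<^sup>2 * k\<close>, where \<open>k\<close> is the squared tangent of the half-opening
  angle. That the volume is affine in \<open>c\<close> is Archimedes' hat-box theorem.\<close>

lemma emeasure_double_cone:
  fixes b :: "real ^ 3"
  assumes b: "b \<in> Basis" and c: "0 < c" "c < 1"
  shows "emeasure lborel {x. norm x \<le> 1 \<and> c * norm x \<le> \<bar>x \<bullet> b\<bar>} = ennreal (4 / 3 * pi * (1 - c))"
proof -
  let ?P = "\<lambda>I. Pi\<^sub>M I (\<lambda>_. lborel :: real measure)"
  interpret product_sigma_finite "\<lambda>_::real^3. lborel :: real measure"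
    by standard
  define A where "A = Basis - {b}"
  have A: "finite A" "b \<notin> A" "Basis = insert b A" "card A = 2"
    using b by (auto simp: A_def card_Diff_singleton)
  define k where "k = 1 / c\<^sup>2 - 1"
  have k: "0 < k" using c by (simp add: k_def field_simps power_less_one_iff)
  define h where "h y = min (1 - y\<^sup>2) (y\<^sup>2 * k)" for y :: real
  have [measurable]: "{x :: real^3. norm x \<le> 1 \<and> c * norm x \<le> \<bar>x \<bullet> b\<bar>} \<in> sets borel"
    by measurable
  let ?S = "{f \<in> space (?P Basis). (\<Sum>i\<in>Basis. (f i)\<^sup>2) \<le> 1 \<and> c\<^sup>2 * (\<Sum>i\<in>Basis. (f i)\<^sup>2) \<le> (f b)\<^sup>2}"
  have comp: "(\<lambda>f. f i) \<in> borel_measurable (?P Basis)" if "i \<in> Basis" for i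
    using measurable_component_singleton[OF that, of "\<lambda>_. lborel :: real measure"] by simp
  then have ssq: "(\<lambda>f. \<Sum>i\<in>Basis. (f i)\<^sup>2) \<in> borel_measurable (?P Basis)"
    by (intro borel_measurable_sum borel_measurable_power)
  have S: "?S \<in> sets (?P Basis)"
    by (intro sets.sets_Collect_conj borel_measurable_le borel_measurable_times
        borel_measurable_power comp ssq b borel_measurable_const)
  have n2: "(norm (\<Sum>i\<in>Basis. f i *\<^sub>R i :: real^3))\<^sup>2 = (\<Sum>i\<in>Basis. (f i)\<^sup>2)" for f
    unfolding power2_norm_eq_inner by (subst euclidean_inner) (simp add: power2_eq_square)
  have le1: "norm x \<le> 1 \<longleftrightarrow> (norm x)\<^sup>2 \<le> 1" for x :: "real^3"
    by (simp add: power_le_one_iff)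
  have lec: "c * norm x \<le> \<bar>x \<bullet> b\<bar> \<longleftrightarrow> c\<^sup>2 * (norm x)\<^sup>2 \<le> (x \<bullet> b)\<^sup>2" for x
    using c by (simp add: abs_le_square_iff[symmetric] power_mult_distrib[symmetric] abs_mult)
  have "emeasure lborel {x. norm x \<le> 1 \<and> c * norm x \<le> \<bar>x \<bullet> b\<bar>} =
     emeasure (?P Basis) ((\<lambda>f. \<Sum>b\<in>Basis. f b *\<^sub>R b) -` {x. norm x \<le> 1 \<and> c * norm x \<le> \<bar>x \<bullet> b\<bar>} \<inter> space (?P Basis))"
    by (subst lborel_eq, subst emeasure_distr) auto
  also have "(\<lambda>f. \<Sum>b\<in>Basis. f b *\<^sub>R b) -` {x. norm x \<le> 1 \<and> c * norm x \<le> \<bar>x \<bullet> b\<bar>} \<inter> space (?P Basis) = ?S"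
    using b by (auto simp: le1 lec n2)
  also have "emeasure (?P Basis) ?S = (\<integral>\<^sup>+ f. indicator ?S f \<partial>?P Basis)"
    using S by simp
  also have "\<dots> = (\<integral>\<^sup>+ y. \<integral>\<^sup>+ x. indicator ?S (x(b := y)) \<partial>?P A \<partial>lborel)"
    using product_nn_integral_insert_rev[OF A(1,2), of "indicator ?S"] S
    unfolding A(3)[symmetric] by simp
  also have "\<dots> = (\<integral>\<^sup>+ y. ennreal (pi * h y) * indicator {-1..1} y \<partial>lborel)"
  proof (intro nn_integral_cong_AE)
    \<comment> \<open>At these heights \<open>h y = 0\<close>, while the disc formula asks for a
      positive radius.\<close>
    have "AE y::real in lborel. y \<notin> {-1,0,1}"
      by (intro AE_not_in countable_imp_null_set_lborel) auto
    then show "AE y in lborel. (\<integral>\<^sup>+ x. indicator ?S (x(b := y)) \<partial>?P A) = ennreal (pi * h y) * indicator {-1..1} y"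
    proof eventually_elim
      case (elim y)
      have sum: "(\<Sum>i\<in>Basis. ((x(b := y)) i)\<^sup>2) = y\<^sup>2 + (\<Sum>i\<in>A. (x i)\<^sup>2)" for x
        using A by (auto simp: A(3) intro!: sum.cong)
      have iff: "x(b := y) \<in> ?S \<longleftrightarrow> (\<Sum>i\<in>A. (x i)\<^sup>2) \<le> h y" if "x \<in> space (?P A)" for x
      proof -
        have "x(b := y) \<in> space (?P Basis)"
          using that A by (auto simp: space_PiM PiE_def extensional_def)
        moreover have "c\<^sup>2 * (y\<^sup>2 + z) \<le> y\<^sup>2 \<longleftrightarrow> z \<le> y\<^sup>2 * k" for z
          using c by (simp add: k_def field_simps)
        moreover have "y\<^sup>2 + z \<le> 1 \<longleftrightarrow> z \<le> 1 - y\<^sup>2" for z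
          by auto
        ultimately show ?thesis
          unfolding mem_Collect_eq sum h_def min.bounded_iff by (simp only: simp_thms fun_upd_same)
      qed
      have "(\<integral>\<^sup>+ x. indicator ?S (x(b := y)) \<partial>?P A) =
         (\<integral>\<^sup>+ x. indicator {f \<in> space (?P A). (\<Sum>i\<in>A. (f i)\<^sup>2) \<le> h y} x \<partial>?P A)"
        using iff by (intro nn_integral_cong) (auto simp: indicator_def)
      also have "\<dots> = emeasure (?P A) {f \<in> space (?P A). (\<Sum>i\<in>A. (f i)\<^sup>2) \<le> h y}"
        using A by (intro nn_integral_indicator) measurable
      also have "\<dots> = ennreal (pi * h y) * indicator {-1..1} y"
      proof (cases "y \<in> {-1..1}")
        case True
        have "y\<^sup>2 < 1" using True elim by (auto simp: abs_square_less_1)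
        moreover have "0 < y\<^sup>2 * k"
          using elim k by simp
        ultimately have "0 < h y" by (simp add: h_def)
        then show ?thesis
          using True A emeasure_PiM_lborel_disc[of A "h y"] by simp
      next
        case False
        then have "1 < y\<^sup>2" by (metis abs_le_iff abs_square_le_1 atLeastAtMost_iff minus_le_iff not_le)
        then have "h y < 0" by (auto simp: h_def min_def)
        then have "{f \<in> space (?P A). (\<Sum>i\<in>A. (f i)\<^sup>2) \<le> h y} = {}"
          by (auto simp: not_le) (meson less_le_trans sum_nonneg zero_le_power2)
        then have "emeasure (?P A) {f \<in> space (?P A). (\<Sum>i\<in>A. (f i)\<^sup>2) \<le> h y} = 0"
          by (simp only: emeasure_empty)
        then show ?thesis using False by simp
      qed
      finally show ?case .
    qed
  qed
  also have "\<dots> = (\<integral>\<^sup>+ y. ennreal (pi * (1 - y\<^sup>2)) * indicator {-1..-c} y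
      + (ennreal (pi * (y\<^sup>2 * k)) * indicator {-c..c} y + ennreal (pi * (1 - y\<^sup>2)) * indicator {c..1} y) \<partial>lborel)"
  proof (intro nn_integral_cong_AE)
    \<comment> \<open>The closed pieces overlap at these two heights, where ball and cone bounds
      coincide.\<close>
    have "AE y::real in lborel. y \<notin> {-c,c}"
      by (intro AE_not_in countable_imp_null_set_lborel) auto
    then show "AE y in lborel. ennreal (pi * h y) * indicator {-1..1} y = ennreal (pi * (1 - y\<^sup>2)) * indicator {-1..-c} y
      + (ennreal (pi * (y\<^sup>2 * k)) * indicator {-c..c} y + ennreal (pi * (1 - y\<^sup>2)) * indicator {c..1} y)"
    proof eventually_elim
      case (elim y)
      have eq: "1 - y\<^sup>2 - y\<^sup>2 * k = 1 - y\<^sup>2 / c\<^sup>2" by (simp add: k_def algebra_simps)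
      show ?case
      proof (cases "\<bar>y\<bar> \<le> c")
        case True
        then have "y\<^sup>2 / c\<^sup>2 \<le> 1" using c by (simp add: abs_le_square_iff[symmetric])
        with eq have "h y = y\<^sup>2 * k" by (simp add: h_def)
        then show ?thesis using True c elim by (auto simp: indicator_def)
      next
        case False
        then have "1 \<le> y\<^sup>2 / c\<^sup>2" using c by (simp add: abs_le_square_iff[symmetric])
        with eq have "h y = 1 - y\<^sup>2" by (simp add: h_def)
        then show ?thesis using False c elim by (auto simp: indicator_def)
      qed
    qed
  qed
  also have "\<dots> = (\<integral>\<^sup>+ y. ennreal (pi * (1 - y\<^sup>2)) * indicator {-1..-c} y \<partial>lborel)
      + ((\<integral>\<^sup>+ y. ennreal (pi * (y\<^sup>2 * k)) * indicator {-c..c} y \<partial>lborel)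
      + (\<integral>\<^sup>+ y. ennreal (pi * (1 - y\<^sup>2)) * indicator {c..1} y \<partial>lborel))"
    by (simp add: nn_integral_add)
  also have "(\<integral>\<^sup>+ y. ennreal (pi * (1 - y\<^sup>2)) * indicator {-1..-c} y \<partial>lborel) =
      ennreal (pi * (-c - (-c)^3/3) - pi * (-1 - (-1)^3/3))"
    using c by (intro nn_integral_FTC_Icc)
      (auto intro!: derivative_eq_intros simp: field_simps power_le_one abs_square_le_1)
  also have "(\<integral>\<^sup>+ y. ennreal (pi * (1 - y\<^sup>2)) * indicator {c..1} y \<partial>lborel) =
      ennreal (pi * (1 - (1)^3/3) - pi * (c - (c)^3/3))"
    using c by (intro nn_integral_FTC_Icc)
      (auto intro!: derivative_eq_intros simp: field_simps power_le_one abs_square_le_1)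
  also have "(\<integral>\<^sup>+ y. ennreal (pi * (y\<^sup>2 * k)) * indicator {-c..c} y \<partial>lborel) =
      ennreal (pi * (c^3/3 * k) - pi * ((-c)^3/3 * k))"
    using c k by (intro nn_integral_FTC_Icc) (auto intro!: derivative_eq_intros)
  finally have *: "emeasure lborel {x. norm x \<le> 1 \<and> c * norm x \<le> \<bar>x \<bullet> b\<bar>} =
    ennreal (pi * (-c - (-c)^3/3) - pi * (-1 - (-1)^3/3)) +
    (ennreal (pi * (c^3/3 * k) - pi * ((-c)^3/3 * k)) +
     ennreal (pi * (1 - (1)^3/3) - pi * (c - (c)^3/3)))" .
  have e1: "pi * (-c - (-c)^3/3) - pi * (-1 - (-1)^3/3) = pi * (2/3 - c + c^3/3)"
    "pi * (1 - (1)^3/3) - pi * (c - (c)^3/3) = pi * (2/3 - c + c^3/3)"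
    "pi * (c^3/3 * k) - pi * ((-c)^3/3 * k) = pi * (2/3 * c - 2/3 * c^3)"
    using c by (simp_all add: k_def field_simps power2_eq_square power3_eq_cube)
  have e2: "2/3 - c + c^3/3 = (1 - c)^2 * (2 + c) / 3" "2/3 * c - 2/3 * c^3 = 2/3 * c * (1 - c^2)"
    by (simp_all add: field_simps power2_eq_square power3_eq_cube)
  have "0 \<le> 2/3 - c + c^3/3" "0 \<le> 2/3 * c - 2/3 * c^3"
    unfolding e2 using c by (simp_all add: power_le_one)
  then show ?thesis
    unfolding * e1 by (subst ennreal_plus[symmetric], simp, simp)+ (simp add: field_simps)
qed

text \<open>Pulling the cap condition back along \<open>sgn\<close> makes it homogeneous, so a pair
  of caps has the volume fraction of a double cone. The two sets differ only at the origin, since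
  \<open>sgn 0 = 0\<close> fails the condition.\<close>

lemma emeasure_uniform_sphere_abs_inner:
  fixes b :: "real ^ 3"
  assumes b: "b \<in> Basis" and c: "0 < c" "c < 1"
  shows "emeasure uniform_sphere {\<theta>. c \<le> \<bar>\<theta> \<bullet> b\<bar>} = ennreal (1 - c)"
proof -
  have [measurable]: "{\<theta> :: real^3. c \<le> \<bar>\<theta> \<bullet> b\<bar>} \<in> sets borel" by measurable
  have "emeasure uniform_sphere {\<theta>. c \<le> \<bar>\<theta> \<bullet> b\<bar>} =
    emeasure (uniform_measure lborel (cball (0::real^3) 1)) {x. c \<le> \<bar>sgn x \<bullet> b\<bar>}"
    unfolding uniform_sphere_def by (subst emeasure_distr) (auto simp: vimage_def)
  also have "\<dots> = emeasure lborel (cball 0 1 \<inter> {x. c \<le> \<bar>sgn x \<bullet> b\<bar>}) / emeasure lborel (cball (0::real^3) 1)"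
    by (subst emeasure_uniform_measure) auto
  also have "emeasure lborel (cball 0 1 \<inter> {x. c \<le> \<bar>sgn x \<bullet> b\<bar>}) = emeasure lborel {x. norm x \<le> 1 \<and> c * norm x \<le> \<bar>x \<bullet> b\<bar>}"
  proof (rule emeasure_eq_AE)
    show "AE x in lborel. (x \<in> cball 0 1 \<inter> {x. c \<le> \<bar>sgn x \<bullet> b\<bar>}) = (x \<in> {x. norm x \<le> 1 \<and> c * norm x \<le> \<bar>x \<bullet> b\<bar>})"
      using AE_lborel_singleton[of "0::real^3"]
    proof eventually_elim
      case (elim x)
      then show ?case
        by (simp add: sgn_div_norm abs_mult field_simps)
    qed
  qed measurable
  also have "\<dots> = ennreal (4 / 3 * pi * (1 - c))"
    using b c by (rule emeasure_double_cone)
  also have "emeasure lborel (cball (0::real^3) 1) = ennreal (4 / 3 * pi)"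
    by (simp add: emeasure_cball eval_unit_ball_vol)
  finally show ?thesis
    using c by (simp add: divide_ennreal)
qed

text \<open>The cap formula covers \<open>0 < c < 1\<close> only; the tail function \<open>p\<close>
  at and outside the endpoints follows by monotonicity, letting \<open>c\<close> tend to 0 or
  1.\<close>

lemma distr_uniform_sphere_abs_inner:
  fixes b :: "real ^ 3"
  assumes b: "b \<in> Basis"
  shows "distr uniform_sphere borel (\<lambda>\<theta>. \<bar>\<theta> \<bullet> b\<bar>) = uniform_measure lborel {0..1}"
proof (rule measure_eqI_lessThan)
  interpret prob_space "uniform_sphere :: (real^3) measure"
    by (rule prob_space_uniform_sphere)
  have sets [measurable_cong, simp]: "sets (uniform_sphere :: (real^3) measure) = sets borel"
    by (simp add: uniform_sphere_def)
  have [simp]: "space (uniform_sphere :: (real^3) measure) = UNIV"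
    by (simp add: uniform_sphere_def)
  define p where "p x = prob {\<theta>. x < \<bar>\<theta> \<bullet> b\<bar>}" for x
  have ge: "prob {\<theta>. c \<le> \<bar>\<theta> \<bullet> b\<bar>} = 1 - c" if "0 < c" "c < 1" for c
    using emeasure_uniform_sphere_abs_inner[OF b that] that by (simp add: measure_def)
  have [measurable]: "{\<theta> :: real^3. c \<le> \<bar>\<theta> \<bullet> b\<bar>} \<in> sets borel" "{\<theta> :: real^3. c < \<bar>\<theta> \<bullet> b\<bar>} \<in> sets borel" for c
    by measurable
  have lower: "1 - c \<le> p x" if "0 < c" "c < 1" "x < c" for x c
    unfolding p_def ge[OF that(1,2), symmetric] using that by (intro finite_measure_mono) auto
  have upper: "p x \<le> 1 - c" if "0 < c" "c < 1" "c \<le> x" for x c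
    unfolding p_def ge[OF that(1,2), symmetric] using that by (intro finite_measure_mono) auto
  have p01: "0 \<le> p x" "p x \<le> 1" for x
    by (auto simp: p_def)
  have p: "p x = (if x \<le> 0 then 1 else if x \<ge> 1 then 0 else 1 - x)" for x
  proof (cases "x \<le> 0"; cases "x \<ge> 1")
    assume x: "x \<le> 0" "\<not> 1 \<le> x"
    have "1 \<le> p x + e" if "e > 0" for e
      using lower[of "min e (1/2)" x] x that by (cases "e \<le> 1 / 2") (auto simp: min_def)
    then have "1 \<le> p x" by (rule field_le_epsilon)
    then show ?thesis using p01[of x] x by simp
  next
    assume x: "\<not> x \<le> 0" "1 \<le> x"
    have "p x \<le> 0 + e" if "e > 0" for e
      using upper[of "max (1/2) (1 - e)" x] x that by (cases "e \<le> 1 / 2") (auto simp: max_def)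
    then have "p x \<le> 0" by (rule field_le_epsilon)
    then show ?thesis using p01[of x] x by simp
  next
    assume x: "\<not> x \<le> 0" "\<not> 1 \<le> x"
    have "1 - x \<le> p x + e" if "e > 0" for e
      using lower[of "min (x + e) ((x + 1) / 2)" x] x that by (cases "x + e \<le> (x + 1) / 2") (auto simp: min_def field_simps)
    then have "1 - x \<le> p x" by (rule field_le_epsilon)
    then show ?thesis using upper[of x x] x by simp
  qed simp
  have eM: "emeasure (distr uniform_sphere borel (\<lambda>\<theta>. \<bar>\<theta> \<bullet> b\<bar>)) {x<..} = ennreal (p x)" for x
    by (subst emeasure_distr) (auto simp: p_def vimage_def emeasure_eq_measure)
  show "emeasure (distr uniform_sphere borel (\<lambda>\<theta>. \<bar>\<theta> \<bullet> b\<bar>)) {x<..} < \<infinity>" for x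
    unfolding eM by simp
  fix x :: real
  have "{0..1} \<inter> {x<..} = (if x < 0 then {0..1} else if x \<ge> 1 then {} else {x<..1})"
    by auto
  then show "emeasure (distr uniform_sphere borel (\<lambda>\<theta>. \<bar>\<theta> \<bullet> b\<bar>)) {x<..} =
      emeasure (uniform_measure lborel {0..1}) {x<..}"
    unfolding eM p by (simp add: divide_ennreal_def)
qed simp_all

lemma LINT_uniform_cos:
  "(LINT y|uniform_measure lborel {0..1}. cos (r * y)) = sinc r"
proof -
  have "uniform_measure lborel {0..1} = density lborel (\<lambda>x. ennreal (indicator {0..1::real} x))"
    by (simp add: uniform_measure_def ennreal_indicator divide_ennreal_def)
  then have "(LINT y|uniform_measure lborel {0..1}. cos (r * y)) = (LINT y|lborel. cos (r * y) * indicator {0..1} y)"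
    by (simp add: integral_density mult.commute)
  also have "\<dots> = sinc r"
  proof (cases "r = 0")
    case False
    have "(LINT y|lborel. cos (r * y) * indicator {0..1} y) = sin (r * 1) / r - sin (r * 0) / r"
      using False by (intro integral_FTC_Icc_real) (auto intro!: derivative_eq_intros)
    with False show ?thesis by simp
  qed simp
  finally show ?thesis .
qed

text \<open>An orthogonal map carries a coordinate axis to the direction of \<open>t\<close>. As
  \<open>cos\<close> is even, the law of the absolute coordinate is all that enters.\<close>

lemma LINT_uniform_sphere_cos:
  fixes t :: "real ^ 3"
  shows "(LINT \<theta>|uniform_sphere. cos (t \<bullet> \<theta>)) = sinc (norm t)"
proof -
  have sets [measurable_cong, simp]: "sets (uniform_sphere :: (real^3) measure) = sets borel"
    by (simp add: uniform_sphere_def)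
  obtain b :: "real ^ 3" where b: "b \<in> Basis"
    using nonempty_Basis by blast
  have "norm (norm t *\<^sub>R b) = norm t"
    using b by simp
  then obtain T where T: "orthogonal_transformation T" "T (norm t *\<^sub>R b) = t"
    by (rule orthogonal_transformation_exists)
  have [measurable]: "T \<in> borel_measurable borel"
    using T(1) by (intro borel_measurable_continuous_onI linear_continuous_on)
      (auto simp: linear_conv_bounded_linear orthogonal_transformation)
  have "(LINT \<theta>|uniform_sphere. cos (t \<bullet> \<theta>)) = (LINT \<theta>|distr uniform_sphere borel T. cos (t \<bullet> \<theta>))"
    using T(1) by (simp add: uniform_sphere_orthogonal_invariant)
  also have "\<dots> = (LINT \<theta>|uniform_sphere. cos (t \<bullet> T \<theta>))"
    by (intro integral_distr) measurable
  also have "\<dots> = (LINT \<theta>|uniform_sphere. cos (norm t * \<bar>\<theta> \<bullet> b\<bar>))"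
  proof (intro Bochner_Integration.integral_cong refl)
    fix \<theta> :: "real^3"
    have "t \<bullet> T \<theta> = norm t * (\<theta> \<bullet> b)"
      using T(1) by (subst T(2)[symmetric]) (simp add: orthogonal_transformation_def inner_commute)
    moreover have "cos (norm t * \<bar>\<theta> \<bullet> b\<bar>) = cos \<bar>norm t * (\<theta> \<bullet> b)\<bar>"
      by (simp add: abs_mult)
    ultimately show "cos (t \<bullet> T \<theta>) = cos (norm t * \<bar>\<theta> \<bullet> b\<bar>)"
      by (simp only: cos_abs_real)
  qed
  also have "\<dots> = (LINT y|distr uniform_sphere borel (\<lambda>\<theta>. \<bar>\<theta> \<bullet> b\<bar>). cos (norm t * y))"
    by (rule integral_distr[symmetric]) measurable
  also have "\<dots> = sinc (norm t)"
    unfolding distr_uniform_sphere_abs_inner[OF b] by (rule LINT_uniform_cos)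
  finally show ?thesis .
qed

section \<open>The sine integral and the mean of the inverse norm\<close>

text \<open>This is the primitive of \<open>(sinc (u / 2))\<^sup>2 / 2\<close> that vanishes at 0.\<close>
definition Si_mean :: "real \<Rightarrow> real" where
  "Si_mean u = Si u - u / 2 * (sinc (u / 2))\<^sup>2"

text \<open>Integration by parts identifies the right-hand side with the mean of \<open>Si\<close>
  over the interval from 0 to \<open>u\<close>, hence the name.\<close>

lemma Si_mean_eq: "u \<noteq> 0 \<Longrightarrow> Si_mean u = Si u - (1 - cos u) / u"
  using cos_double_sin[of "u / 2"] by (simp add: Si_mean_def power_divide field_simps power2_eq_square)

lemma Si_0 [simp]: "Si 0 = 0"
  by (simp add: Si_def zero_ereal_def)

lemma Si_mean_0 [simp]: "Si_mean 0 = 0"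
  by (simp add: Si_mean_def)

lemma DERIV_Si_mean: "(Si_mean has_real_derivative (sinc (u / 2))\<^sup>2 / 2) (at u)"
proof (cases "u = 0")
  case True
  have "isCont (\<lambda>u. (sinc (u / 2))\<^sup>2 / 2) 0"
    by (intro isCont_power isCont_divide isCont_o2[where g=sinc, OF _ isCont_sinc] continuous_intros) auto
  then have "((\<lambda>u. u / 2 * (sinc (u / 2))\<^sup>2) has_real_derivative 1 / 2) (at 0)"
    \<comment> \<open>Caratheodory's form of the derivative: the difference quotient at 0 is
      continuous and has the value \<open>1 / 2\<close> there. Subtracting this from
      \<open>Si' = 1\<close> leaves \<open>1 / 2\<close>.\<close>
    unfolding CARAT_DERIV by (intro exI[of _ "\<lambda>u. (sinc (u / 2))\<^sup>2 / 2"]) auto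
  from DERIV_diff[OF DERIV_Si[of 0] this] show ?thesis
    using True by (simp add: Si_mean_def[abs_def] cong: if_cong)
next
  case False
  have eq: "(sinc (u / 2))\<^sup>2 / 2 = (1 - cos u) / u\<^sup>2"
    using False cos_double_sin[of "u / 2"] by (simp add: power_divide field_simps)
  have "((\<lambda>u. Si u - (1 - cos u) / u) has_real_derivative (1 - cos u) / u\<^sup>2) (at u)"
    using False by (auto intro!: derivative_eq_intros DERIV_Si simp: field_simps power2_eq_square)
  then show ?thesis
    unfolding eq
    by (rule has_field_derivative_transform_within_open[where S="- {0}"])
       (use False in \<open>auto simp: Si_mean_eq\<close>)
qed

lemma Si_mean_mono: "u \<le> v \<Longrightarrow> Si_mean u \<le> Si_mean v"
  by (rule DERIV_nonneg_imp_nondecreasing) (auto intro!: exI DERIV_Si_mean)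

lemma Si_mean_nonneg: "0 \<le> u \<Longrightarrow> 0 \<le> Si_mean u"
  using Si_mean_mono[of 0 u] by simp

lemma Si_mean_at_top: "(Si_mean \<longlongrightarrow> pi / 2) at_top"
proof -
  have "((\<lambda>u::real. (1 - cos u) / u) \<longlongrightarrow> 0) at_top"
  proof (rule Lim_null_comparison)
    show "((\<lambda>u. 2 / u) \<longlongrightarrow> (0::real)) at_top"
      by (intro tendsto_divide_0[OF tendsto_const] filterlim_at_top_imp_at_infinity filterlim_ident)
    show "\<forall>\<^sub>F u in at_top. norm ((1 - cos u) / u) \<le> 2 / u"
      using eventually_gt_at_top[of 0]
    proof eventually_elim
      case (elim u)
      have "\<bar>1 - cos u\<bar> \<le> 2" using cos_ge_minus_one[of u] cos_le_one[of u] by linarith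
      then show ?case using elim by (simp add: abs_divide divide_right_mono)
    qed
  qed
  from tendsto_diff[OF Si_at_top this] have "((\<lambda>u. Si u - (1 - cos u) / u) \<longlongrightarrow> pi / 2) at_top"
    by simp
  moreover have "\<forall>\<^sub>F u in at_top. Si u - (1 - cos u) / u = Si_mean u"
    using eventually_gt_at_top[of 0] by eventually_elim (simp add: Si_mean_eq)
  ultimately show ?thesis
    by (rule Lim_transform_eventually)
qed

text \<open>The value of \<open>I 2\<close> for \<open>sinc\<close>: after rescaling by 2,
  \<open>Si_mean\<close> is a primitive of the integrand, so its limit at infinity is the
  integral.\<close>

lemma nn_integral_sinc_squared:
  "(\<integral>\<^sup>+ r. ennreal ((sinc r)\<^sup>2) * indicator {0..} r \<partial>lborel) = ennreal (pi / 2)"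
proof -
  have "((\<lambda>r. Si_mean (2 * r)) \<longlongrightarrow> pi / 2) at_top"
    by (rule filterlim_compose[OF Si_mean_at_top]) (intro filterlim_tendsto_pos_mult_at_top[OF tendsto_const] filterlim_ident, simp)
  moreover have "((\<lambda>r. Si_mean (2 * r)) has_real_derivative (sinc r)\<^sup>2) (at r)" for r
  proof -
    have "((\<lambda>r. 2 * r) has_real_derivative 2) (at r)"
      by (auto intro!: derivative_eq_intros)
    from DERIV_chain2[OF DERIV_Si_mean this] show ?thesis by (cases "r = 0") simp_all
  qed
  ultimately show ?thesis
    using nn_integral_FTC_atLeast[of "\<lambda>r. (sinc r)\<^sup>2" 0 "\<lambda>r. Si_mean (2 * r)" "pi / 2"] by auto
qed

text \<open>The weight \<open>- r / T\<close> adds \<open>cos (r * x) / (T * x\<^sup>2)\<close> to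
  the primitive \<open>Si (r * x) / x\<close>; its increment is exactly the correction that turns
  \<open>Si\<close> into \<open>Si_mean\<close>.\<close>

lemma LINT_triangle_sinc:
  assumes T: "0 < T" and x: "0 < x"
  shows "(LINT r|lborel. (1 - r / T) * sinc (r * x) * indicator {0..T} r) = Si_mean (T * x) / x"
proof -
  have "(LINT r|lborel. (1 - r / T) * sinc (r * x) * indicator {0..T} r) =
    (Si (T * x) / x + cos (T * x) / (T * x\<^sup>2)) - (Si (0 * x) / x + cos (0 * x) / (T * x\<^sup>2))"
  proof (intro integral_FTC_Icc_real)
    fix r assume "0 \<le> r" "r \<le> T"
    have "((\<lambda>r. Si (r * x)) has_real_derivative sinc (r * x) * x) (at r)"
      by (rule DERIV_chain2[OF DERIV_Si]) (auto intro!: derivative_eq_intros)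
    then have "((\<lambda>r. Si (r * x) / x + cos (r * x) / (T * x\<^sup>2)) has_real_derivative
        sinc (r * x) * x / x + (- sin (r * x) * x) / (T * x\<^sup>2)) (at r)"
      by (intro DERIV_add DERIV_cdivide) (auto intro!: derivative_eq_intros)
    moreover have "sinc (r * x) * x / x + (- sin (r * x) * x) / (T * x\<^sup>2) = (1 - r / T) * sinc (r * x)"
      using T x by (auto simp: field_simps power2_eq_square)
    ultimately show "((\<lambda>r. Si (r * x) / x + cos (r * x) / (T * x\<^sup>2)) has_real_derivative (1 - r / T) * sinc (r * x)) (at r)"
      by simp
    show "isCont (\<lambda>r. (1 - r / T) * sinc (r * x)) r"
      using T by (intro isCont_mult isCont_o2[where g=sinc, OF _ isCont_sinc] continuous_intros) auto
  qed (use T in auto)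
  also have "\<dots> = Si_mean (T * x) / x"
    using T x by (simp add: Si_mean_eq field_simps power2_eq_square)
  finally show ?thesis .
qed

text \<open>In polar coordinates this is the measure with density \<open>1 / (4 * pi * (norm t)\<^sup>2)\<close>.\<close>
definition ray_measure :: "(real ^ 3) measure" where
  "ray_measure = distr (density (lborel \<Otimes>\<^sub>M uniform_sphere) (\<lambda>(r, \<theta>). indicator {0<..} r)) borel (\<lambda>(r, \<theta>). r *\<^sub>R \<theta>)"

section \<open>Integration along random rays\<close>

lemma ray_measure_alt:
  "ray_measure = distr (density (lborel \<Otimes>\<^sub>M uniform_sphere) (\<lambda>z. ennreal (indicator {0<..} (fst z)))) borel (\<lambda>z. fst z *\<^sub>R snd z)"
  by (simp add: ray_measure_def case_prod_beta' ennreal_indicator)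

lemma sets_uniform_sphere [measurable_cong, simp]: "sets uniform_sphere = sets borel"
  by (simp add: uniform_sphere_def)

lemma space_uniform_sphere [simp]: "space uniform_sphere = UNIV"
  by (simp add: uniform_sphere_def)

lemma sets_ray_measure [measurable_cong, simp]: "sets ray_measure = sets borel"
  by (simp add: ray_measure_def)

lemma space_ray_measure [simp]: "space ray_measure = UNIV"
  by (simp add: ray_measure_def)

lemma sigma_finite_uniform_sphere: "sigma_finite_measure (uniform_sphere :: 'a::euclidean_space measure)"
proof -
  interpret prob_space "uniform_sphere :: 'a measure" by (rule prob_space_uniform_sphere)
  show ?thesis by unfold_locales
qed

lemma nn_integral_ray_measure:
  assumes [measurable]: "h \<in> borel_measurable borel"
  shows "(\<integral>\<^sup>+ t. h t \<partial>ray_measure) = (\<integral>\<^sup>+ r. (\<integral>\<^sup>+ \<theta>. h (r *\<^sub>R \<theta>) \<partial>uniform_sphere) * indicator {0<..} r \<partial>lborel)"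
proof -
  interpret sigma_finite_measure "uniform_sphere :: (real^3) measure"
    by (rule sigma_finite_uniform_sphere)
  have "(\<integral>\<^sup>+ t. h t \<partial>ray_measure) =
    (\<integral>\<^sup>+ z. (case z of (r, \<theta>) \<Rightarrow> indicator {0<..} r * h (r *\<^sub>R \<theta>)) \<partial>(lborel \<Otimes>\<^sub>M uniform_sphere))"
    unfolding ray_measure_def
    by (subst nn_integral_distr, measurable, subst nn_integral_density, measurable)
      (auto simp: case_prod_beta intro!: nn_integral_cong)
  also have "\<dots> = (\<integral>\<^sup>+ r. \<integral>\<^sup>+ \<theta>. indicator {0<..} r * h (r *\<^sub>R \<theta>) \<partial>uniform_sphere \<partial>lborel)"
    by (subst nn_integral_fst[symmetric]) (auto simp: case_prod_beta)
  also have "\<dots> = (\<integral>\<^sup>+ r. (\<integral>\<^sup>+ \<theta>. h (r *\<^sub>R \<theta>) \<partial>uniform_sphere) * indicator {0<..} r \<partial>lborel)"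
    by (intro nn_integral_cong) (simp add: nn_integral_cmult mult.commute)
  finally show ?thesis .
qed

lemma nn_integral_ray_measure_radial:
  assumes [measurable]: "h \<in> borel_measurable borel"
  shows "(\<integral>\<^sup>+ t. h (norm t) \<partial>ray_measure) = (\<integral>\<^sup>+ r. h r * indicator {0<..} r \<partial>lborel)"
proof -
  interpret prob_space "uniform_sphere :: (real^3) measure" by (rule prob_space_uniform_sphere)
  have "(\<integral>\<^sup>+ \<theta>. h (norm (r *\<^sub>R \<theta>)) \<partial>(uniform_sphere :: (real^3) measure)) * indicator {0<..} r = h r * indicator {0<..} r" for r
  proof (cases "0 < r")
    case True
    have "AE \<theta> in (uniform_sphere :: (real^3) measure). h (norm (r *\<^sub>R \<theta>)) = h r"
      using AE_uniform_sphere True by (auto elim!: eventually_mono)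
    then have "(\<integral>\<^sup>+ \<theta>. h (norm (r *\<^sub>R \<theta>)) \<partial>(uniform_sphere :: (real^3) measure)) = (\<integral>\<^sup>+ \<theta>. h r \<partial>(uniform_sphere :: (real^3) measure))"
      by (rule nn_integral_cong_AE)
    also have "\<dots> = h r" using emeasure_space_1 by simp
    finally show ?thesis by simp
  qed simp
  then show ?thesis
    by (subst nn_integral_ray_measure) (simp_all add: mult.commute)
qed

text \<open>The radial part is one-dimensional Lebesgue measure, so the Jacobian is
  \<open>1 / c\<close> rather than a cube. This is where the factor \<open>sqrt s\<close> in Ball's
  inequality originates.\<close>

lemma nn_integral_ray_measure_scale:
  assumes [measurable]: "h \<in> borel_measurable borel" and c: "0 < c"
  shows "(\<integral>\<^sup>+ t. h (c *\<^sub>R t) \<partial>ray_measure) = ennreal (1 / c) * (\<integral>\<^sup>+ t. h t \<partial>ray_measure)"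
proof -
  interpret sigma_finite_measure "uniform_sphere :: (real^3) measure"
    by (rule sigma_finite_uniform_sphere)
  let ?g = "\<lambda>r. (\<integral>\<^sup>+ \<theta>. h (r *\<^sub>R \<theta>) \<partial>uniform_sphere) * indicator {0<..} r"
  have [measurable]: "?g \<in> borel_measurable lborel"
    by measurable
  have "(\<integral>\<^sup>+ t. h t \<partial>ray_measure) = (\<integral>\<^sup>+ r. ?g r \<partial>lborel)"
    by (simp add: nn_integral_ray_measure)
  also have "\<dots> = ennreal c * (\<integral>\<^sup>+ r. ?g (0 + c * r) \<partial>lborel)"
    using c by (subst nn_integral_real_affine[where c=c and t=0]) auto
  also have "(\<integral>\<^sup>+ r. ?g (0 + c * r) \<partial>lborel) = (\<integral>\<^sup>+ t. h (c *\<^sub>R t) \<partial>ray_measure)"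
    using c by (subst nn_integral_ray_measure)
      (auto intro!: nn_integral_cong simp: indicator_def zero_less_mult_iff)
  finally show ?thesis
    using c by (simp add: mult.assoc[symmetric] ennreal_mult[symmetric])
qed

section \<open>Triangular cut-off of the radius\<close>

definition triangle_weight :: "real \<Rightarrow> real \<Rightarrow> real" where
  "triangle_weight T r = (1 - r / T) * indicator {0..T} r"

text \<open>\<open>2 / pi * inverse_kernel T x\<close> increases to \<open>1 / x\<close> as \<open>T\<close> grows; it is a truncation of
  \<open>1 / x = 2 / pi * (LBINT r=0..\<infinity>. sinc (r * x))\<close>, which converges only conditionally.\<close>
definition inverse_kernel :: "real \<Rightarrow> real \<Rightarrow> real" where
  "inverse_kernel T x = (if x = 0 then T / 2 else Si_mean (T * x) / x)"

lemma triangle_weight_measurable [measurable]: "triangle_weight T \<in> borel_measurable borel"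
  unfolding triangle_weight_def[abs_def] by measurable

lemma triangle_weight_bounds: "0 < T \<Longrightarrow> 0 \<le> triangle_weight T r" "0 < T \<Longrightarrow> triangle_weight T r \<le> 1"
  by (auto simp: triangle_weight_def indicator_def)

lemma triangle_weight_mono: "0 < S \<Longrightarrow> S \<le> T \<Longrightarrow> triangle_weight S r \<le> triangle_weight T r"
  by (auto simp: triangle_weight_def indicator_def intro!: divide_left_mono)

lemma inverse_kernel_eq:
  assumes "0 < T" "0 \<le> x"
  shows "(LINT r|lborel. triangle_weight T r * sinc (r * x)) = inverse_kernel T x"
proof (cases "x = 0")
  case True
  have "(LINT r|lborel. (1 - r / T) * indicator {0..T} r) = (T - T\<^sup>2 / (2 * T)) - (0 - 0\<^sup>2 / (2 * T))"
    using assms by (intro integral_FTC_Icc_real) (auto intro!: derivative_eq_intros)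
  with True assms show ?thesis
    by (simp add: inverse_kernel_def triangle_weight_def power2_eq_square)
next
  case False
  with assms LINT_triangle_sinc[of T x] show ?thesis
    by (simp add: inverse_kernel_def triangle_weight_def mult_ac cong: if_cong)
qed

lemma integrable_triangle: "0 < T \<Longrightarrow> integrable lborel (triangle_weight T)"
  unfolding triangle_weight_def[abs_def]
  using borel_integrable_atLeastAtMost[of 0 T "\<lambda>r. 1 - r / T"] by simp

lemma nn_integral_triangle:
  "0 < T \<Longrightarrow> (\<integral>\<^sup>+ t. ennreal (triangle_weight T (norm t)) \<partial>ray_measure) < \<infinity>"
proof -
  assume T: "0 < T"
  have "(\<integral>\<^sup>+ t. ennreal (triangle_weight T (norm t)) \<partial>ray_measure) = (\<integral>\<^sup>+ r. ennreal (triangle_weight T r) * indicator {0<..} r \<partial>lborel)"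
    by (rule nn_integral_ray_measure_radial[of "\<lambda>r. ennreal (triangle_weight T r)"]) simp
  also have "\<dots> \<le> (\<integral>\<^sup>+ r. ennreal (triangle_weight T r) \<partial>lborel)"
    by (intro nn_integral_mono) (simp add: indicator_def)
  also have "\<dots> < \<infinity>"
    using nn_integral_eq_integral[OF integrable_triangle[OF T]] T by (simp add: triangle_weight_bounds)
  finally show ?thesis .
qed

lemma integrable_triangle_ray_measure:
  assumes T: "0 < T" and [measurable]: "h \<in> borel_measurable borel" and h: "\<And>t. \<bar>h t\<bar> \<le> 1"
  shows "integrable ray_measure (\<lambda>t. triangle_weight T (norm t) * h t)"
proof (rule Bochner_Integration.integrable_bound)
  show "integrable ray_measure (\<lambda>t. triangle_weight T (norm t))"
    using nn_integral_triangle[OF T] T by (intro integrableI_nonneg) (auto simp: triangle_weight_bounds)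
  show "AE t in ray_measure. norm (triangle_weight T (norm t) * h t) \<le> norm (triangle_weight T (norm t))"
    using T h by (auto simp: abs_mult triangle_weight_bounds intro!: mult_left_le)
qed simp

lemma LINT_triangle_cos:
  fixes x :: "real ^ 3"
  assumes T: "0 < T"
  shows "(LINT t|ray_measure. triangle_weight T (norm t) * cos (t \<bullet> x)) = inverse_kernel T (norm x)"
proof -
  interpret prob_space "uniform_sphere :: (real^3) measure" by (rule prob_space_uniform_sphere)
  interpret P: pair_sigma_finite "lborel :: real measure" "uniform_sphere :: (real^3) measure" ..
  let ?w = "\<lambda>t. triangle_weight T (norm t) * cos (t \<bullet> x)"
  have int: "integrable ray_measure ?w"
    using T by (rule integrable_triangle_ray_measure) auto
  have meas: "(\<lambda>z. case z of (r, \<theta>) \<Rightarrow> indicator {0<..} r * ?w (r *\<^sub>R \<theta>)) \<in> borel_measurable (lborel \<Otimes>\<^sub>M (uniform_sphere :: (real^3) measure))"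
    by measurable
  have int2: "integrable (lborel \<Otimes>\<^sub>M uniform_sphere) (\<lambda>z. case z of (r, \<theta>) \<Rightarrow> indicator {0<..} r * ?w (r *\<^sub>R \<theta>))"
    using int by (simp add: ray_measure_alt integrable_distr_eq integrable_density case_prod_beta)
  have "(LINT t|ray_measure. ?w t) =
    (LINT z|(lborel \<Otimes>\<^sub>M uniform_sphere). (case z of (r, \<theta>) \<Rightarrow> indicator {0<..} r * ?w (r *\<^sub>R \<theta>)))"
    by (simp add: ray_measure_alt integral_distr integral_density case_prod_beta)
  also have "\<dots> = (LINT r|lborel. LINT \<theta>|uniform_sphere. indicator {0<..} r * ?w (r *\<^sub>R \<theta>))"
    using P.integral_fst'[OF int2] by simp
  also have "\<dots> = (LINT r|lborel. triangle_weight T r * sinc (r * norm x))"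
  proof (rule integral_cong_AE)
    have eq: "(LINT \<theta>|uniform_sphere. indicator {0<..} r * ?w (r *\<^sub>R \<theta>)) = triangle_weight T r * sinc (r * norm x)" if "0 < r" for r
    proof -
      have "(LINT \<theta>|uniform_sphere. indicator {0<..} r * ?w (r *\<^sub>R \<theta>)) = (LINT \<theta>|uniform_sphere. triangle_weight T r * cos ((r *\<^sub>R x) \<bullet> \<theta>))"
        using that AE_uniform_sphere
        by (intro integral_cong_AE) (auto simp: inner_commute elim!: eventually_mono)
      also have "\<dots> = triangle_weight T r * sinc (r * norm x)"
        using that LINT_uniform_sphere_cos[of "r *\<^sub>R x"] by (simp cong: if_cong)
      finally show ?thesis .
    qed
    have neg: "triangle_weight T r = 0" if "r < 0" for r
      using that by (simp add: triangle_weight_def)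
    \<comment> \<open>Both sides vanish for \<open>r < 0\<close>; at \<open>r = 0\<close> the
      indicator and the weight disagree, but this is a null set.\<close>
    show "AE r in lborel. (LINT \<theta>|uniform_sphere. indicator {0<..} r * ?w (r *\<^sub>R \<theta>)) = triangle_weight T r * sinc (r * norm x)"
      using AE_lborel_singleton[of "0::real"]
    proof eventually_elim
      case (elim r)
      then consider "r < 0" | "0 < r" by linarith
      then show ?case
      proof cases
        case 1
        then have "indicator {0<..} r = (0::real)" by simp
        then show ?thesis unfolding neg[OF 1] by (simp only: mult_zero_left Bochner_Integration.integral_zero)
      qed (rule eq)
    qed
  qed measurable
  also have "\<dots> = inverse_kernel T (norm x)"
    using T by (rule inverse_kernel_eq) simp
  finally show ?thesis .
qed

text \<open>The cut-off makes \<open>Q\<close>, the ray measure weighted by the triangle, finite.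
  Since \<open>cos\<close> is bounded, Fubini holds for every law \<open>\<nu>\<close>, even if
  \<open>1 / norm x\<close> is not integrable.\<close>

lemma
  fixes \<nu> :: "(real ^ 3) measure"
  assumes \<nu>: "prob_space \<nu>" "sets \<nu> = sets borel" and T: "0 < T"
  shows integrable_inverse_kernel: "integrable \<nu> (\<lambda>x. inverse_kernel T (norm x))"
    and LINT_inverse_kernel: "(LINT x|\<nu>. inverse_kernel T (norm x)) =
      (LINT t|ray_measure. triangle_weight T (norm t) * (LINT x|\<nu>. cos (t \<bullet> x)))"
proof -
  interpret N: prob_space \<nu> by fact
  note \<nu>(2)[measurable_cong]
  define Q where "Q = density ray_measure (\<lambda>t. ennreal (triangle_weight T (norm t)))"
  have sQ [measurable_cong]: "sets Q = sets borel" by (simp add: Q_def)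
  interpret Q: finite_measure Q
    using nn_integral_triangle[OF T] by (intro finite_measureI) (simp add: Q_def emeasure_density)
  interpret P: pair_sigma_finite Q \<nu> ..
  interpret QN: finite_measure "Q \<Otimes>\<^sub>M \<nu>"
    by (intro finite_measure_pair_measure) unfold_locales
  have int: "integrable (Q \<Otimes>\<^sub>M \<nu>) (\<lambda>(t, x). cos (t \<bullet> x))"
    by (rule QN.integrable_const_bound[where B=1]) (auto simp: case_prod_beta)
  have Q: "(LINT t|Q. g t) = (LINT t|ray_measure. triangle_weight T (norm t) * g t)" if [measurable]: "g \<in> borel_measurable borel" for g :: "real^3 \<Rightarrow> real"
    unfolding Q_def using T by (subst integral_density) (auto simp: triangle_weight_bounds)
  have eq: "(LINT t|Q. cos (t \<bullet> x)) = inverse_kernel T (norm x)" for x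
    using T by (simp add: Q LINT_triangle_cos)
  show "integrable \<nu> (\<lambda>x. inverse_kernel T (norm x))"
    using P.integrable_snd[OF int] by (simp add: eq)
  have "(LINT x|\<nu>. inverse_kernel T (norm x)) = (LINT x|\<nu>. LINT t|Q. cos (t \<bullet> x))"
    by (simp add: eq)
  also have "\<dots> = (LINT t|Q. LINT x|\<nu>. cos (t \<bullet> x))"
    using P.Fubini_integral[OF int] by simp
  also have "\<dots> = (LINT t|ray_measure. triangle_weight T (norm t) * (LINT x|\<nu>. cos (t \<bullet> x)))"
    by (rule Q) measurable
  finally show "(LINT x|\<nu>. inverse_kernel T (norm x)) =
      (LINT t|ray_measure. triangle_weight T (norm t) * (LINT x|\<nu>. cos (t \<bullet> x)))" .
qed

lemma inverse_kernel_nonneg: "0 < T \<Longrightarrow> 0 \<le> x \<Longrightarrow> 0 \<le> inverse_kernel T x"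
  by (simp add: inverse_kernel_def Si_mean_nonneg)

text \<open>This is the reason for a triangular cut-off: a sharp one would give
  \<open>Si (T * x) / x\<close>, which oscillates in \<open>T\<close>, whereas
  \<open>Si_mean\<close> is nondecreasing.\<close>

lemma inverse_kernel_mono: "0 < S \<Longrightarrow> S \<le> T \<Longrightarrow> 0 \<le> x \<Longrightarrow> inverse_kernel S x \<le> inverse_kernel T x"
  by (auto simp: inverse_kernel_def intro!: divide_right_mono Si_mean_mono)

text \<open>At \<open>x = 0\<close> the truncated values are \<open>T / pi\<close>, which is
  unbounded and matches \<open>inverse 0 = \<top>\<close> in \<open>ennreal\<close>. So an atom at
  the origin is counted correctly.\<close>

lemma SUP_inverse_kernel:
  assumes x: "0 \<le> x"
  shows "(SUP k. ennreal (2 / pi * inverse_kernel (real (Suc k)) x)) = inverse (ennreal x)"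
proof (cases "x = 0")
  case True
  have "(SUP k. ennreal (2 / pi * inverse_kernel (real (Suc k)) x)) = top"
  proof (rule ennreal_SUP_eq_top)
    fix n :: nat
    obtain k where "real n * pi \<le> real k"
      using real_arch_simple by blast
    then have "real n \<le> real (Suc k) / pi"
      by (simp add: field_simps)
    then have "of_nat n \<le> ennreal (2 / pi * inverse_kernel (real (Suc k)) x)"
      using True by (simp add: inverse_kernel_def ennreal_of_nat_eq_real_of_nat field_simps del: of_nat_Suc)
    then show "\<exists>k\<in>UNIV. of_nat n \<le> ennreal (2 / pi * inverse_kernel (real (Suc k)) x)"
      by blast
  qed
  with True show ?thesis by simp
next
  case False
  with x have x: "0 < x" by simp
  have "filterlim (\<lambda>k. real (Suc k) * x) at_top sequentially"
    by (rule filterlim_at_top_mult_tendsto_pos[OF tendsto_const x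
        filterlim_compose[OF filterlim_real_sequentially filterlim_Suc]])
  from filterlim_compose[OF Si_mean_at_top this]
  have "(\<lambda>k. 2 / pi * (Si_mean (real (Suc k) * x) / x)) \<longlonglongrightarrow> 2 / pi * (pi / 2 / x)"
    by (intro tendsto_intros) (use x in auto)
  then have "(\<lambda>k. ennreal (2 / pi * inverse_kernel (real (Suc k)) x)) \<longlonglongrightarrow> ennreal (1 / x)"
    using x by (intro tendsto_ennrealI) (simp add: inverse_kernel_def)
  moreover have "(\<lambda>k. ennreal (2 / pi * inverse_kernel (real (Suc k)) x)) \<longlonglongrightarrow> (SUP k. ennreal (2 / pi * inverse_kernel (real (Suc k)) x))"
    using x by (intro LIMSEQ_SUP) (auto simp: incseq_def intro!: ennreal_leI divide_right_mono mult_left_mono inverse_kernel_mono)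
  ultimately show ?thesis
    using LIMSEQ_unique x by (fastforce simp: inverse_ennreal inverse_eq_divide)
qed

lemma SUP_triangle:
  assumes r: "0 \<le> r"
  shows "(SUP k. ennreal (triangle_weight (real (Suc k)) r)) = 1"
proof -
  have "(\<lambda>k. 1 - r / real (Suc k)) \<longlonglongrightarrow> 1 - 0"
    by (intro tendsto_diff tendsto_const LIMSEQ_Suc[OF lim_const_over_n])
  moreover have "\<forall>\<^sub>F k in sequentially. 1 - r / real (Suc k) = triangle_weight (real (Suc k)) r"
    using eventually_ge_at_top[of "nat \<lceil>r\<rceil>"]
  proof eventually_elim
    case (elim k)
    then have "r \<le> real (Suc k)" by linarith
    with r show ?case by (simp add: triangle_weight_def)
  qed
  ultimately have "(\<lambda>k. triangle_weight (real (Suc k)) r) \<longlonglongrightarrow> 1 - 0"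
    by (rule Lim_transform_eventually)
  from tendsto_ennrealI[OF this] have "(\<lambda>k. ennreal (triangle_weight (real (Suc k)) r)) \<longlonglongrightarrow> 1"
    by (simp only: diff_zero ennreal_1)
  moreover have "(\<lambda>k. ennreal (triangle_weight (real (Suc k)) r)) \<longlonglongrightarrow> (SUP k. ennreal (triangle_weight (real (Suc k)) r))"
    by (intro LIMSEQ_SUP) (auto simp: incseq_def intro!: ennreal_leI triangle_weight_mono)
  ultimately show ?thesis
    using LIMSEQ_unique by blast
qed

lemma nn_integral_inverse_norm:
  fixes \<nu> :: "(real ^ 3) measure"
  assumes \<nu>: "prob_space \<nu>" "sets \<nu> = sets borel"
  shows "(\<integral>\<^sup>+ x. inverse (ennreal (norm x)) \<partial>\<nu>) =
    (SUP k. ennreal (2 / pi) * ennreal (LINT t|ray_measure. triangle_weight (real (Suc k)) (norm t) * (LINT x|\<nu>. cos (t \<bullet> x))))"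
proof -
  note \<nu>(2)[measurable_cong]
  have [measurable]: "Si_mean \<in> borel_measurable borel"
    unfolding Si_mean_def[abs_def] by measurable
  then have [measurable]: "inverse_kernel T \<in> borel_measurable borel" for T
    unfolding inverse_kernel_def[abs_def] by measurable
  have "(\<integral>\<^sup>+ x. inverse (ennreal (norm x)) \<partial>\<nu>) = (\<integral>\<^sup>+ x. (SUP k. ennreal (2 / pi * inverse_kernel (real (Suc k)) (norm x))) \<partial>\<nu>)"
    by (simp only: SUP_inverse_kernel norm_ge_zero)
  also have "\<dots> = (SUP k. \<integral>\<^sup>+ x. ennreal (2 / pi * inverse_kernel (real (Suc k)) (norm x)) \<partial>\<nu>)"
    by (intro nn_integral_monotone_convergence_SUP)
      (auto simp: incseq_def le_fun_def intro!: ennreal_leI divide_right_mono mult_left_mono inverse_kernel_mono)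
  also have "\<dots> = (SUP k. ennreal (2 / pi) * ennreal (LINT t|ray_measure. triangle_weight (real (Suc k)) (norm t) * (LINT x|\<nu>. cos (t \<bullet> x))))"
  proof (intro SUP_cong refl)
    fix k
    have "(\<integral>\<^sup>+ x. ennreal (2 / pi * inverse_kernel (real (Suc k)) (norm x)) \<partial>\<nu>) =
      ennreal (2 / pi) * (\<integral>\<^sup>+ x. ennreal (inverse_kernel (real (Suc k)) (norm x)) \<partial>\<nu>)"
      by (subst nn_integral_cmult[symmetric]) (auto simp: ennreal_mult'[symmetric] inverse_kernel_nonneg intro!: nn_integral_cong)
    also have "(\<integral>\<^sup>+ x. ennreal (inverse_kernel (real (Suc k)) (norm x)) \<partial>\<nu>) = ennreal (LINT x|\<nu>. inverse_kernel (real (Suc k)) (norm x))"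
      using \<nu> by (intro nn_integral_eq_integral integrable_inverse_kernel) (auto simp: inverse_kernel_nonneg)
    also have "(LINT x|\<nu>. inverse_kernel (real (Suc k)) (norm x)) = (LINT t|ray_measure. triangle_weight (real (Suc k)) (norm t) * (LINT x|\<nu>. cos (t \<bullet> x)))"
      using \<nu> by (intro LINT_inverse_kernel) auto
    finally show "(\<integral>\<^sup>+ x. ennreal (2 / pi * inverse_kernel (real (Suc k)) (norm x)) \<partial>\<nu>) =
      ennreal (2 / pi) * ennreal (LINT t|ray_measure. triangle_weight (real (Suc k)) (norm t) * (LINT x|\<nu>. cos (t \<bullet> x)))" .
  qed
  finally show ?thesis .
qed

lemma abs_LINT_cos_le_1:
  fixes \<nu> :: "(real ^ 3) measure"
  assumes "prob_space \<nu>" "sets \<nu> = sets borel"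
  shows "\<bar>LINT x|\<nu>. cos (t \<bullet> x)\<bar> \<le> 1"
proof -
  interpret prob_space \<nu> by fact
  note assms(2)[measurable_cong]
  have "\<bar>LINT x|\<nu>. cos (t \<bullet> x)\<bar> \<le> (LINT x|\<nu>. \<bar>cos (t \<bullet> x)\<bar>)"
    by (rule integral_abs_bound)
  also have "\<dots> \<le> (LINT x|\<nu>. 1)"
    by (intro integral_mono integrable_const_bound[where B=1]) auto
  finally show ?thesis by (simp add: prob_space)
qed

lemma nn_integral_triangle_mult:
  assumes T: "0 < T" and h: "h \<in> borel_measurable borel" "\<And>t. 0 \<le> h t" "\<And>t. h t \<le> 1"
  shows "ennreal (LINT t|ray_measure. triangle_weight T (norm t) * h t) = (\<integral>\<^sup>+ t. ennreal (triangle_weight T (norm t)) * ennreal (h t) \<partial>ray_measure)"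
  using integrable_triangle_ray_measure[OF T h(1)] h T
  by (subst nn_integral_eq_integral[symmetric]) (auto simp: ennreal_mult' triangle_weight_bounds intro!: nn_integral_cong)

text \<open>The characteristic function may change sign, so before the cut-off is removed it is
  replaced by its absolute value; this is why only an upper bound results.\<close>

lemma nn_integral_inverse_norm_le:
  fixes \<nu> :: "(real ^ 3) measure"
  assumes \<nu>: "prob_space \<nu>" "sets \<nu> = sets borel"
  shows "(\<integral>\<^sup>+ x. inverse (ennreal (norm x)) \<partial>\<nu>) \<le> ennreal (2 / pi) * (\<integral>\<^sup>+ t. ennreal \<bar>LINT x|\<nu>. cos (t \<bullet> x)\<bar> \<partial>ray_measure)"
proof -
  interpret prob_space \<nu> by fact
  note \<nu>(2)[measurable_cong]
  let ?\<psi> = "\<lambda>t. LINT x|\<nu>. cos (t \<bullet> x)"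
  have [measurable]: "?\<psi> \<in> borel_measurable borel"
    by measurable
  have "ennreal (LINT t|ray_measure. triangle_weight (real (Suc k)) (norm t) * ?\<psi> t) \<le> (\<integral>\<^sup>+ t. ennreal \<bar>?\<psi> t\<bar> \<partial>ray_measure)" for k
  proof -
    have "ennreal (LINT t|ray_measure. triangle_weight (real (Suc k)) (norm t) * ?\<psi> t) \<le> ennreal (LINT t|ray_measure. triangle_weight (real (Suc k)) (norm t) * \<bar>?\<psi> t\<bar>)"
      using abs_LINT_cos_le_1[OF \<nu>]
      by (intro ennreal_leI integral_mono integrable_triangle_ray_measure mult_left_mono) (auto simp: triangle_weight_bounds)
    also have "\<dots> = (\<integral>\<^sup>+ t. ennreal (triangle_weight (real (Suc k)) (norm t)) * ennreal \<bar>?\<psi> t\<bar> \<partial>ray_measure)"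
      using abs_LINT_cos_le_1[OF \<nu>] by (intro nn_integral_triangle_mult) auto
    also have "\<dots> \<le> (\<integral>\<^sup>+ t. ennreal \<bar>?\<psi> t\<bar> \<partial>ray_measure)"
      by (intro nn_integral_mono) (auto simp: triangle_weight_bounds ennreal_mult[symmetric] intro!: ennreal_leI mult_left_le_one_le)
    finally show ?thesis .
  qed
  then show ?thesis
    unfolding nn_integral_inverse_norm[OF \<nu>] by (intro SUP_least mult_left_mono) auto
qed

text \<open>With a nonnegative characteristic function the cut-off integrands increase to it, and
  monotone convergence gives equality. Both sides may be infinite.\<close>

lemma nn_integral_inverse_norm_eq:
  fixes \<nu> :: "(real ^ 3) measure"
  assumes \<nu>: "prob_space \<nu>" "sets \<nu> = sets borel" and nonneg: "\<And>t. 0 \<le> (LINT x|\<nu>. cos (t \<bullet> x))"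
  shows "(\<integral>\<^sup>+ x. inverse (ennreal (norm x)) \<partial>\<nu>) = ennreal (2 / pi) * (\<integral>\<^sup>+ t. ennreal (LINT x|\<nu>. cos (t \<bullet> x)) \<partial>ray_measure)"
proof -
  interpret prob_space \<nu> by fact
  note \<nu>(2)[measurable_cong]
  let ?\<psi> = "\<lambda>t. LINT x|\<nu>. cos (t \<bullet> x)"
  have [measurable]: "?\<psi> \<in> borel_measurable borel"
    by measurable
  have le1: "?\<psi> t \<le> 1" for t
    using abs_LINT_cos_le_1[OF \<nu>, of t] by simp
  have "(\<integral>\<^sup>+ x. inverse (ennreal (norm x)) \<partial>\<nu>) =
      (SUP k. ennreal (2 / pi) * (\<integral>\<^sup>+ t. ennreal (triangle_weight (real (Suc k)) (norm t)) * ennreal (?\<psi> t) \<partial>ray_measure))"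
    using nonneg le1 by (simp add: nn_integral_inverse_norm[OF \<nu>] nn_integral_triangle_mult)
  also have "\<dots> = ennreal (2 / pi) * (SUP k. \<integral>\<^sup>+ t. ennreal (triangle_weight (real (Suc k)) (norm t)) * ennreal (?\<psi> t) \<partial>ray_measure)"
    by (simp add: SUP_mult_left_ennreal)
  also have "(SUP k. \<integral>\<^sup>+ t. ennreal (triangle_weight (real (Suc k)) (norm t)) * ennreal (?\<psi> t) \<partial>ray_measure) =
      (\<integral>\<^sup>+ t. (SUP k. ennreal (triangle_weight (real (Suc k)) (norm t)) * ennreal (?\<psi> t)) \<partial>ray_measure)"
    by (intro nn_integral_monotone_convergence_SUP[symmetric])
      (auto simp: incseq_def le_fun_def intro!: mult_right_mono ennreal_leI triangle_weight_mono)
  also have "\<dots> = (\<integral>\<^sup>+ t. ennreal (?\<psi> t) \<partial>ray_measure)"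
    by (simp add: SUP_mult_right_ennreal[symmetric] SUP_triangle del: of_nat_Suc)
  finally show ?thesis .
qed

section \<open>Estimates for the sinc function\<close>

lemma sinc_bounds:
  assumes "0 < r"
  shows "\<bar>sinc r\<bar> \<le> 1" "\<bar>sinc r\<bar> \<le> 1 / r"
  using assms abs_sin_x_le_abs_x[of r] by (auto simp: abs_divide divide_right_mono)

lemma sin_ge_mult_cos:
  assumes "0 \<le> x" "x \<le> pi"
  shows "x * cos x \<le> sin x"
proof -
  have "0 * cos 0 - sin 0 \<ge> x * cos x - sin x"
  proof (rule DERIV_nonpos_imp_nonincreasing[OF assms(1), of "\<lambda>x. x * cos x - sin x"])
    fix y assume "0 \<le> y" "y \<le> x"
    then show "\<exists>d. ((\<lambda>x. x * cos x - sin x) has_real_derivative d) (at y) \<and> d \<le> 0"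
      using assms by (intro exI[of _ "- y * sin y"]) (auto intro!: derivative_eq_intros mult_nonneg_nonneg sin_ge_zero)
  qed
  then show ?thesis by simp
qed

text \<open>The product \<open>sinc x * exp (x\<^sup>2 / 6)\<close> starts at 1 and decreases:
  \<open>aux\<close> is the sign of its derivative. The rate \<open>1 / 6\<close> is the second
  Taylor coefficient of \<open>sinc\<close>, hence the best one possible near 0.\<close>

lemma sinc_le_exp:
  assumes r: "0 < r" "r \<le> pi"
  shows "sinc r \<le> exp (- r\<^sup>2 / 6)"
proof -
  have aux: "3 * (x * cos x - sin x) + x\<^sup>2 * sin x \<le> 0" if x: "0 \<le> x" "x \<le> pi" for x
  proof -
    have "3 * (0 * cos 0 - sin 0) + 0\<^sup>2 * sin 0 \<ge> 3 * (x * cos x - sin x) + x\<^sup>2 * sin x"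
    proof (rule DERIV_nonpos_imp_nonincreasing[OF x(1), of "\<lambda>x. 3 * (x * cos x - sin x) + x\<^sup>2 * sin x"])
      fix y assume y: "0 \<le> y" "y \<le> x"
      have "y * (y * cos y - sin y) \<le> 0"
        using y x sin_ge_mult_cos[of y] by (intro mult_nonneg_nonpos) auto
      then show "\<exists>d. ((\<lambda>x. 3 * (x * cos x - sin x) + x\<^sup>2 * sin x) has_real_derivative d) (at y) \<and> d \<le> 0"
        by (intro exI[of _ "y * (y * cos y - sin y)"])
          (auto intro!: derivative_eq_intros simp: algebra_simps power2_eq_square)
    qed
    then show ?thesis by simp
  qed
  define h where "h x = sinc x * exp (x\<^sup>2 / 6)" for x
  have "h r \<le> h 0"
  proof (rule DERIV_nonpos_imp_decreasing_open[of 0 r h])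
    fix x assume x: "0 < x" "x < r"
    have "((\<lambda>x. sin x / x * exp (x\<^sup>2 / 6)) has_real_derivative
       (3 * (x * cos x - sin x) + x\<^sup>2 * sin x) / (3 * x\<^sup>2) * exp (x\<^sup>2 / 6)) (at x)"
      using x by (auto intro!: derivative_eq_intros simp: field_simps power2_eq_square)
    then have "(h has_real_derivative (3 * (x * cos x - sin x) + x\<^sup>2 * sin x) / (3 * x\<^sup>2) * exp (x\<^sup>2 / 6)) (at x)"
      by (rule has_field_derivative_transform_within_open[where S="{0<..}"]) (use x in \<open>auto simp: h_def\<close>)
    moreover have "(3 * (x * cos x - sin x) + x\<^sup>2 * sin x) / (3 * x\<^sup>2) * exp (x\<^sup>2 / 6) \<le> 0"
      using aux[of x] x r by (intro mult_nonpos_nonneg divide_nonpos_pos) auto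
    ultimately show "\<exists>d. (h has_real_derivative d) (at x) \<and> d \<le> 0" by blast
  next
    show "continuous_on {0..r} h"
      unfolding h_def by (intro continuous_on_mult continuous_on_sinc continuous_intros) auto
  qed (use r in simp)
  then show ?thesis
    by (simp add: h_def exp_minus field_simps)
qed

lemma nn_integral_sinc_cubed_tail:
  "(\<integral>\<^sup>+ r. ennreal (\<bar>sinc r\<bar> ^ 3) * indicator {pi..} r \<partial>lborel) \<le> ennreal (1 / (4 * pi\<^sup>2))"
proof -
  \<comment> \<open>\<open>?G\<close> comes from integrating \<open>(1 - cos (2 * r)) / (2 * r ^ 3)\<close> by parts twice; the remaining
    integrand is completed to the nonnegative second summand of \<open>?f\<close>.\<close>
  let ?f = "\<lambda>r::real. (1 - cos (2 * r)) / (2 * r ^ 3) + 3 / 2 * (1 - cos (2 * r)) / r ^ 5"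
  let ?G = "\<lambda>r::real. - 1 / (4 * r\<^sup>2) - sin (2 * r) / (4 * r ^ 3) + 3 * cos (2 * r) / (8 * r ^ 4) - 3 / (8 * r ^ 4)"
  have "(\<integral>\<^sup>+ r. ennreal (\<bar>sinc r\<bar> ^ 3) * indicator {pi..} r \<partial>lborel) \<le> (\<integral>\<^sup>+ r. ennreal (?f r) * indicator {pi..} r \<partial>lborel)"
  proof (intro nn_integral_mono)
    fix r :: real
    show "ennreal (\<bar>sinc r\<bar> ^ 3) * indicator {pi..} r \<le> ennreal (?f r) * indicator {pi..} r"
    proof (cases "pi \<le> r")
      case True
      then have r: "0 < r" using pi_gt_zero by linarith
      \<comment> \<open>Lowering the exponent removes the absolute value and leaves an expression in
        \<open>cos (2 * r)\<close>.\<close>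
      have "\<bar>sin r\<bar> ^ 3 \<le> \<bar>sin r\<bar> ^ 2"
        by (intro power_decreasing) auto
      also have "\<dots> = (1 - cos (2 * r)) / 2"
        by (simp add: cos_double_sin)
      finally have "\<bar>sinc r\<bar> ^ 3 \<le> (1 - cos (2 * r)) / (2 * r ^ 3)"
        using r by (simp add: abs_divide power_divide divide_right_mono flip: divide_divide_eq_left)
      also have "\<dots> \<le> ?f r" using r by simp
      finally show ?thesis using True by (simp add: ennreal_leI del: sinc_neg)
    qed simp
  qed
  also have "\<dots> = ennreal (0 - ?G pi)"
  proof (rule nn_integral_FTC_atLeast)
    fix r :: real assume "pi \<le> r"
    then have r: "0 < r" using pi_gt_zero by linarith
    show "(?G has_real_derivative ?f r) (at r)"
      using r by (auto intro!: derivative_eq_intros simp: field_simps eval_nat_numeral)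
    show "0 \<le> ?f r" using r by simp
  next
    show "(?G \<longlongrightarrow> 0) at_top" by real_asymp
  qed measurable
  \<comment> \<open>At \<open>pi\<close> the sine vanishes and the two quartic terms cancel.\<close>
  also have "0 - ?G pi = 1 / (4 * pi\<^sup>2)" by simp
  finally show ?thesis .
qed

text \<open>The last term is the bound \<open>r ^ 11 / 11!\<close> on the remainder of
  \<open>sin\<close>, divided by \<open>r\<close>; hence its sign is positive, against the
  alternating pattern.\<close>

lemma sinc_le_poly:
  assumes r: "0 < r"
  shows "sinc r \<le> 1 - r\<^sup>2 / 6 + r ^ 4 / 120 - r ^ 6 / 5040 + r ^ 8 / 362880 + r ^ 10 / 39916800"
proof -
  have "(\<Sum>m<11. sin_coeff m * r ^ m) = r - r ^ 3 / 6 + r ^ 5 / 120 - r ^ 7 / 5040 + r ^ 9 / 362880"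
    by (simp add: sin_coeff_def lessThan_nat_numeral lessThan_Suc fact_numeral)
  moreover have "sin r - (\<Sum>m<11. sin_coeff m * r ^ m) \<le> inverse (fact 11) * \<bar>r\<bar> ^ 11"
    using Maclaurin_sin_bound[of r 11] abs_ge_self order_trans by blast
  ultimately have "sin r \<le> r - r ^ 3 / 6 + r ^ 5 / 120 - r ^ 7 / 5040 + r ^ 9 / 362880 + r ^ 11 / 39916800"
    using r by (simp add: fact_numeral)
  also have "\<dots> = (1 - r\<^sup>2 / 6 + r ^ 4 / 120 - r ^ 6 / 5040 + r ^ 8 / 362880 + r ^ 10 / 39916800) * r"
    by (simp add: algebra_simps eval_nat_numeral)
  finally show ?thesis
    using r by (simp add: divide_le_eq)
qed

text \<open>With \<open>x = r\<^sup>2\<close> this is the cube of the upper bound for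
  \<open>sinc\<close>, expanded so that it can be integrated term by term.\<close>

lemma sinc_poly_cubed:
  fixes x :: real
  shows "(1 - 1 / 6 * x + 1 / 120 * x ^ 2 - 1 / 5040 * x ^ 3 + 1 / 362880 * x ^ 4 + 1 / 39916800 * x ^ 5)^3 = 1 - 1 / 2 * x + 13 / 120 * x ^ 2 - 41 / 3024 * x ^ 3 + 671 / 604800 * x ^ 4 - 2549 / 39916800 * x ^ 5 + 22571 / 8382528000 * x ^ 6 - 67 / 798336000 * x ^ 7 + 4561 / 2414168064000 * x ^ 8 - 14369 / 506975293440000 * x ^ 9 + 4453 / 22306912911360000 * x ^ 10 + 211 / 133841477468160000 * x ^ 11 - 941 / 20649827952230400000 * x ^ 12 + 19 / 96365863777075200000 * x ^ 13 + 1 / 192731727554150400000 * x ^ 14 + 1 / 63601470092869632000000 * x ^ 15"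
  by (simp add: field_simps eval_nat_numeral)

lemma nn_integral_sinc_cubed_head:
  "(\<integral>\<^sup>+ r. ennreal (\<bar>sinc r\<bar> ^ 3) * indicator {0..pi} r \<partial>lborel) \<le> ennreal (11898 / 10000)"
proof -
  let ?p = "\<lambda>x::real. 1 - 1 / 6 * x + 1 / 120 * x ^ 2 - 1 / 5040 * x ^ 3 + 1 / 362880 * x ^ 4 + 1 / 39916800 * x ^ 5"
  let ?P = "\<lambda>r::real. 1 - 1 / 2 * r ^ 2 + 13 / 120 * r ^ 4 - 41 / 3024 * r ^ 6 + 671 / 604800 * r ^ 8 - 2549 / 39916800 * r ^ 10 + 22571 / 8382528000 * r ^ 12 - 67 / 798336000 * r ^ 14 + 4561 / 2414168064000 * r ^ 16 - 14369 / 506975293440000 * r ^ 18 + 4453 / 22306912911360000 * r ^ 20 + 211 / 133841477468160000 * r ^ 22 - 941 / 20649827952230400000 * r ^ 24 + 19 / 96365863777075200000 * r ^ 26 + 1 / 192731727554150400000 * r ^ 28 + 1 / 63601470092869632000000 * r ^ 30"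
  let ?F = "\<lambda>r::real. 1 * r - 1 / 6 * r ^ 3 + 13 / 600 * r ^ 5 - 41 / 21168 * r ^ 7 + 671 / 5443200 * r ^ 9 - 2549 / 439084800 * r ^ 11 + 22571 / 108972864000 * r ^ 13 - 67 / 11975040000 * r ^ 15 + 4561 / 41040857088000 * r ^ 17 - 14369 / 9632530575360000 * r ^ 19 + 4453 / 468445171138560000 * r ^ 21 + 211 / 3078353981767680000 * r ^ 23 - 941 / 516245698805760000000 * r ^ 25 + 19 / 2601878321981030400000 * r ^ 27 + 1 / 5589220099070361600000 * r ^ 29 + 1 / 1971645572878958592000000 * r ^ 31"
  have P: "?P r = (?p (r\<^sup>2)) ^ 3" for r
    unfolding sinc_poly_cubed by (simp flip: power_mult)
  have le: "sinc r \<le> ?p (r\<^sup>2)" if "0 < r" for r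
    using sinc_le_poly[OF that] by (simp flip: power_mult)
  have pi: "pi \<le> 22 / 7" using pi_approx by simp
  \<comment> \<open>The domain is enlarged from \<open>pi\<close> to \<open>22 / 7\<close> so that
    the primitive is evaluated at a rational point. Up to \<open>pi\<close> the polynomial dominates
    \<open>sinc r \<ge> 0\<close>; beyond, terms with positive coefficients are bounded at the left
    end and the others at the right end.\<close>
  have nonneg: "0 \<le> ?p (r\<^sup>2)" if r: "0 \<le> r" "r \<le> 22 / 7" for r
  proof (cases "r \<le> pi")
    case True
    show ?thesis
    proof (cases "r = 0")
      case False
      with r True have "0 \<le> sinc r" by (auto intro!: divide_nonneg_pos sin_ge_zero)
      then show ?thesis using le[of r] False r by linarith
    qed simp
  next
    case False
    then have "314159 / 100000 \<le> r" using pi_approx by simp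
    then have lower: "(314159 / 100000) ^ k \<le> r ^ k" for k by (intro power_mono) auto
    have upper: "r ^ k \<le> (22 / 7) ^ k" for k using r by (intro power_mono) auto
    show ?thesis
      using lower[of 4] lower[of 8] lower[of 10] upper[of 2] upper[of 6]
      by (simp add: power_divide flip: power_mult)
  qed
  have "(\<integral>\<^sup>+ r. ennreal (\<bar>sinc r\<bar> ^ 3) * indicator {0..pi} r \<partial>lborel) \<le> (\<integral>\<^sup>+ r. ennreal (?P r) * indicator {0..22 / 7} r \<partial>lborel)"
  proof (intro nn_integral_mono)
    fix r :: real
    show "ennreal (\<bar>sinc r\<bar> ^ 3) * indicator {0..pi} r \<le> ennreal (?P r) * indicator {0..22 / 7} r"
    proof (cases "r \<in> {0..pi}")
      case True
      have "0 \<le> sinc r" using True by (auto intro!: divide_nonneg_nonneg sin_ge_zero)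
      moreover have "sinc r \<le> ?p (r\<^sup>2)" using le[of r] True by (cases "r = 0") auto
      ultimately have "\<bar>sinc r\<bar> ^ 3 \<le> ?P r" unfolding P by (intro power_mono) auto
      then show ?thesis using True pi by (simp add: ennreal_leI del: sinc_neg)
    qed simp
  qed
  also have "\<dots> = ennreal (?F (22 / 7) - ?F 0)"
  proof (rule nn_integral_FTC_Icc)
    fix r :: real assume "r \<in> {0..22 / 7}"
    then have r: "0 \<le> r" "r \<le> 22 / 7" by auto
    show "0 \<le> ?P r" unfolding P using nonneg[OF r] by simp
    show "(?F has_real_derivative ?P r) (at r)"
      by ((rule derivative_eq_intros refl)+) simp
  qed auto
  also have "\<dots> \<le> ennreal (11898 / 10000)"
    by (intro ennreal_leI) (simp add: power_divide)
  finally show ?thesis .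
qed

section \<open>Auxiliary inequalities and radial integrals\<close>

lemma Youngs_inequality_weak:
  fixes a :: real
  assumes "0 \<le> \<alpha>" "0 \<le> \<beta>" "\<alpha> + \<beta> = 1" "0 \<le> a" "0 \<le> b"
  shows "a powr \<alpha> * b powr \<beta> \<le> \<alpha> * a + \<beta> * b"
\<comment> \<open>Since \<open>0 powr x = 0\<close> even for \<open>x = 0\<close>, the left-hand
  side vanishes if a base does.\<close>
proof (cases "a = 0 \<or> b = 0")
  case False
  with assms show ?thesis by (intro Youngs_inequality_0) auto
qed (use assms in auto)

lemma power3_le_add:
  fixes x y :: real
  assumes "x \<le> y + k" "0 \<le> k" "0 \<le> x" "x \<le> 1" "0 \<le> y" "y \<le> 1"
  shows "x ^ 3 \<le> y ^ 3 + 3 * k"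
proof (cases "x \<le> y")
  case True
  then have "x ^ 3 \<le> y ^ 3" using assms by (intro power_mono)
  then show ?thesis using assms(2) by linarith
next
  case False
  have "x ^ 3 - y ^ 3 = (x - y) * (x * x + x * y + y * y)"
    by (simp add: power3_eq_cube algebra_simps)
  also have "\<dots> \<le> k * (1 * 1 + 1 * 1 + 1 * 1)"
    using False assms by (intro mult_mono add_mono) auto
  finally show ?thesis by simp
qed

lemma power2_le_add:
  fixes x y :: real
  assumes "x \<le> y + k" "0 \<le> k" "0 \<le> x" "x \<le> 1" "0 \<le> y" "y \<le> 1"
  shows "x\<^sup>2 \<le> y\<^sup>2 + 2 * k"
proof (cases "x \<le> y")
  case True
  then have "x\<^sup>2 \<le> y\<^sup>2" using assms by (intro power_mono)
  then show ?thesis using assms(2) by linarith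
next
  case False
  have "x\<^sup>2 - y\<^sup>2 = (x - y) * (x + y)"
    by (simp add: power2_eq_square algebra_simps)
  also have "\<dots> \<le> k * (1 + 1)"
    using False assms by (intro mult_mono add_mono) auto
  finally show ?thesis by simp
qed

lemma abs_sinc_le_1: "\<bar>sinc r\<bar> \<le> 1"
  using sinc_bounds(1)[of "\<bar>r\<bar>"] by (cases "r < 0"; cases "r = 0") auto

lemma nn_integral_indicator_norm:
  "0 \<le> a \<Longrightarrow> (\<integral>\<^sup>+ t. ennreal c * indicator {0..a} (norm t) \<partial>ray_measure) = ennreal c * ennreal a"
proof -
  assume a: "0 \<le> a"
  have "(\<integral>\<^sup>+ t. ennreal c * indicator {0..a} (norm t) \<partial>ray_measure) = (\<integral>\<^sup>+ r. ennreal c * indicator {0..a} r * indicator {0<..} r \<partial>lborel)"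
    by (rule nn_integral_ray_measure_radial) simp
  also have "\<dots> = (\<integral>\<^sup>+ r. ennreal c * indicator {0<..a} r \<partial>lborel)"
    by (intro nn_integral_cong) (auto simp: indicator_def)
  also have "\<dots> = ennreal c * ennreal a"
    using a by (simp add: nn_integral_cmult_indicator)
  finally show ?thesis .
qed

lemma nn_integral_inverse_power_tail:
  assumes \<rho>: "0 < \<rho>" and k: "1 \<le> k" and c: "0 \<le> c"
  shows "(\<integral>\<^sup>+ r. ennreal (c / r ^ Suc k) * indicator {\<rho>..} r \<partial>lborel) = ennreal (c / (k * \<rho> ^ k))"
proof -
  let ?F = "\<lambda>x::real. - c / real k * inverse x ^ k"
  have "(\<integral>\<^sup>+ r. ennreal (c / r ^ Suc k) * indicator {\<rho>..} r \<partial>lborel) = ennreal (0 - ?F \<rho>)"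
  proof (rule nn_integral_FTC_atLeast)
    fix x assume "\<rho> \<le> x"
    then have x: "0 < x" using \<rho> by simp
    have "(?F has_real_derivative - c / real k * (real k * (- (inverse x ^ Suc (Suc 0))) * inverse x ^ (k - 1))) (at x)"
      using x by (auto intro!: derivative_eq_intros)
    also have "- c / real k * (real k * (- (inverse x ^ Suc (Suc 0))) * inverse x ^ (k - 1)) = c / x ^ Suc k"
      using x k by (cases k) (simp_all add: field_simps power_inverse del: of_nat_Suc)
    finally show "(?F has_real_derivative c / x ^ Suc k) (at x)" .
    show "0 \<le> c / x ^ Suc k" using c x by simp
  next
    have "(?F \<longlongrightarrow> - c / real k * 0 ^ k) at_top"
      by (intro tendsto_intros tendsto_inverse_0_at_top filterlim_ident)
    moreover have "(0::real) ^ k = 0" using k by simp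
    ultimately show "(?F \<longlongrightarrow> 0) at_top" by simp
  qed simp
  then show ?thesis by (simp add: power_inverse divide_inverse mult.assoc)
qed

lemma nn_integral_exp_square:
  assumes b: "0 < b"
  shows "(\<integral>\<^sup>+ r. ennreal (exp (- (b * r\<^sup>2))) * indicator {0<..} r \<partial>lborel) = ennreal (sqrt (pi / b) / 2)"
proof -
  have "(\<integral>\<^sup>+ r. ennreal (indicator {0..} r *\<^sub>R exp (- r\<^sup>2)) \<partial>lborel) = ennreal (sqrt pi / 2)"
    using gaussian_moment_0 by (intro nn_integral_eq_integral[THEN trans]) (auto simp: has_bochner_integral_iff)
  also have "(\<integral>\<^sup>+ r. ennreal (indicator {0..} r *\<^sub>R exp (- r\<^sup>2)) \<partial>lborel) =
    ennreal (sqrt b) * (\<integral>\<^sup>+ r. ennreal (indicator {0..} (0 + sqrt b * r) *\<^sub>R exp (- (0 + sqrt b * r)\<^sup>2)) \<partial>lborel)"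
    using b by (subst nn_integral_real_affine[where c="sqrt b" and t=0]) auto
  also have "(\<integral>\<^sup>+ r. ennreal (indicator {0..} (0 + sqrt b * r) *\<^sub>R exp (- (0 + sqrt b * r)\<^sup>2)) \<partial>lborel) =
    (\<integral>\<^sup>+ r. ennreal (exp (- (b * r\<^sup>2))) * indicator {0<..} r \<partial>lborel)"
    using AE_lborel_singleton[of "0::real"] b
    by (intro nn_integral_cong_AE) (auto elim!: eventually_mono simp: indicator_def power_mult_distrib zero_le_mult_iff)
  finally have *: "ennreal (sqrt b) * (\<integral>\<^sup>+ r. ennreal (exp (- (b * r\<^sup>2))) * indicator {0<..} r \<partial>lborel) = ennreal (sqrt pi / 2)" .
  have "(\<integral>\<^sup>+ r. ennreal (exp (- (b * r\<^sup>2))) * indicator {0<..} r \<partial>lborel) =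
    ennreal (1 / sqrt b) * (ennreal (sqrt b) * (\<integral>\<^sup>+ r. ennreal (exp (- (b * r\<^sup>2))) * indicator {0<..} r \<partial>lborel))"
    using b by (simp add: mult.assoc[symmetric] ennreal_mult[symmetric])
  also have "\<dots> = ennreal (sqrt (pi / b) / 2)"
    unfolding * using b by (simp add: ennreal_mult[symmetric] real_sqrt_divide)
  finally show ?thesis .
qed

section \<open>The integral inequality near the uniform distribution\<close>

text \<open>Up to the radius \<open>R\<close> the function \<open>f\<close> differs from \<open>\<bar>sinc\<bar>\<close> by at most \<open>\<kappa>\<close>; beyond
  \<open>R\<close> only the decay \<open>C / norm t\<close> is used.\<close>

locale near_sphere =
  fixes f :: "real ^ 3 \<Rightarrow> real" and C d :: real
  assumes f_measurable [measurable]: "f \<in> borel_measurable borel"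
    and f_nonneg: "0 \<le> f t" and f_le_1: "f t \<le> 1"
    and C: "1 \<le> C" and f_decay: "t \<noteq> 0 \<Longrightarrow> f t \<le> C / norm t"
    and d: "0 \<le> d" "d \<le> 1 / (10 ^ 30 * C ^ 9)"
    and f_close: "\<bar>f t - \<bar>sinc (norm t)\<bar>\<bar> \<le> d * (norm t)\<^sup>2"
begin

text \<open>A balance of two errors: the part of the cubic integral beyond \<open>R\<close> is at
  most \<open>C ^ 3 / (2 * R\<^sup>2) = 1 / (2000000 * C)\<close>, and comparison with
  \<open>sinc\<close> inside costs a multiple of
  \<open>\<kappa> * R = d * R ^ 3 = 10 ^ 9 * C ^ 6 * d\<close>, which the bound on \<open>d\<close>
  makes negligible.\<close>

definition R :: real where "R = 1000 * C\<^sup>2"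

definition \<kappa> :: real where "\<kappa> = d * R\<^sup>2"

lemma R_ge: "1000 \<le> R"
  using power_mono[OF C, of 2] by (simp add: R_def)

lemma \<kappa>: "0 \<le> \<kappa>" "\<kappa> * R \<le> 1 / 10 ^ 20" "\<kappa> \<le> 1 / 10 ^ 20"
proof -
  show "0 \<le> \<kappa>" using d by (simp add: \<kappa>_def)
  have "\<kappa> * R = d * (10 ^ 9 * C ^ 6)"
    by (simp add: \<kappa>_def R_def power_mult_distrib flip: power_mult power_add)
  also have "\<dots> \<le> 1 / (10 ^ 30 * C ^ 9) * (10 ^ 9 * C ^ 9)"
    using d C by (intro mult_mono mult_left_mono power_increasing) auto
  also have "\<dots> \<le> 1 / 10 ^ 20" using C by simp
  finally show *: "\<kappa> * R \<le> 1 / 10 ^ 20" .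
  have "\<kappa> * 1 \<le> \<kappa> * R" using \<open>0 \<le> \<kappa>\<close> R_ge by (intro mult_left_mono) auto
  with * show "\<kappa> \<le> 1 / 10 ^ 20" by simp
qed

lemma near:
  assumes "norm t \<le> R"
  shows "f t \<le> \<bar>sinc (norm t)\<bar> + \<kappa>" "\<bar>sinc (norm t)\<bar> \<le> f t + \<kappa>"
proof -
  have "d * (norm t)\<^sup>2 \<le> \<kappa>"
    unfolding \<kappa>_def using assms d by (intro mult_left_mono power_mono) auto
  with f_close[of t] show "f t \<le> \<bar>sinc (norm t)\<bar> + \<kappa>" "\<bar>sinc (norm t)\<bar> \<le> f t + \<kappa>"
    by linarith+
qed

lemma f_cubed_near:
  assumes "norm t \<le> R"
  shows "ennreal (f t ^ 3) \<le> ennreal (\<bar>sinc (norm t)\<bar> ^ 3) + ennreal (3 * \<kappa>)"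
proof -
  have "f t ^ 3 \<le> \<bar>sinc (norm t)\<bar> ^ 3 + 3 * \<kappa>"
    by (intro power3_le_add near(1) assms \<kappa>(1) f_nonneg f_le_1 abs_sinc_le_1 abs_ge_zero)
  then have "ennreal (f t ^ 3) \<le> ennreal (\<bar>sinc (norm t)\<bar> ^ 3 + 3 * \<kappa>)"
    by (rule ennreal_leI)
  also have "\<dots> = ennreal (\<bar>sinc (norm t)\<bar> ^ 3) + ennreal (3 * \<kappa>)"
    using \<kappa>(1) by (intro ennreal_plus) simp_all
  finally show ?thesis .
qed

lemma sinc_squared_near:
  assumes "norm t \<le> R"
  shows "ennreal ((sinc (norm t))\<^sup>2) \<le> ennreal ((f t)\<^sup>2) + ennreal (2 * \<kappa>)"
proof -
  have "\<bar>sinc (norm t)\<bar>\<^sup>2 \<le> (f t)\<^sup>2 + 2 * \<kappa>"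
    by (intro power2_le_add near(2) assms \<kappa>(1) f_nonneg f_le_1 abs_sinc_le_1 abs_ge_zero)
  then have "ennreal ((sinc (norm t))\<^sup>2) \<le> ennreal ((f t)\<^sup>2 + 2 * \<kappa>)"
    unfolding power2_abs by (rule ennreal_leI)
  also have "\<dots> = ennreal ((f t)\<^sup>2) + ennreal (2 * \<kappa>)"
    using \<kappa>(1) by (intro ennreal_plus) simp_all
  finally show ?thesis .
qed

section \<open>Integrals of the square and the cube of \<open>f\<close>\<close>

lemma f_squared_lower: "ennreal (1569 / 1000) \<le> (\<integral>\<^sup>+ t. ennreal ((f t)\<^sup>2) \<partial>ray_measure)"
proof -
  let ?I = "\<integral>\<^sup>+ t. ennreal ((f t)\<^sup>2) \<partial>ray_measure"
  have "ennreal (pi / 2) = (\<integral>\<^sup>+ r. ennreal ((sinc r)\<^sup>2) * indicator {0..} r \<partial>lborel)"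
    by (simp only: nn_integral_sinc_squared)
  also have "\<dots> = (\<integral>\<^sup>+ r. ennreal ((sinc r)\<^sup>2) * indicator {0<..} r \<partial>lborel)"
    using AE_lborel_singleton[of "0::real"]
    by (intro nn_integral_cong_AE) (auto elim!: eventually_mono simp: indicator_def)
  also have "\<dots> = (\<integral>\<^sup>+ t. ennreal ((sinc (norm t))\<^sup>2) \<partial>ray_measure)"
    by (rule nn_integral_ray_measure_radial[symmetric]) measurable
  \<comment> \<open>Beyond \<open>R\<close> the square of \<open>sinc\<close> is at most
    \<open>1 / r\<^sup>2\<close>, which integrates to \<open>1 / R\<close>. The total loss against
    \<open>pi / 2\<close> is \<open>2 * (\<kappa> * R) + 1 / R\<close>, just above
    \<open>1 / 1000\<close> at worst.\<close>
  also have "\<dots> \<le> (\<integral>\<^sup>+ t. ennreal ((f t)\<^sup>2) + (ennreal (2 * \<kappa>) * indicator {0..R} (norm t) + ennreal (1 / norm t ^ Suc 1) * indicator {R..} (norm t)) \<partial>ray_measure)"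
  proof (intro nn_integral_mono)
    fix t :: "real ^ 3"
    show "ennreal ((sinc (norm t))\<^sup>2) \<le> ennreal ((f t)\<^sup>2) + (ennreal (2 * \<kappa>) * indicator {0..R} (norm t) + ennreal (1 / norm t ^ Suc 1) * indicator {R..} (norm t))"
    proof (cases "norm t \<le> R")
      case True
      have "ennreal ((sinc (norm t))\<^sup>2) \<le> ennreal ((f t)\<^sup>2) + ennreal (2 * \<kappa>)"
        by (rule sinc_squared_near[OF True])
      also have "\<dots> \<le> ennreal ((f t)\<^sup>2) + (ennreal (2 * \<kappa>) * indicator {0..R} (norm t) + ennreal (1 / norm t ^ Suc 1) * indicator {R..} (norm t))"
        using True by (intro add_left_mono) simp
      finally show ?thesis .
    next
      case False
      then have t: "0 < norm t" using R_ge by linarith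
      have "\<bar>sinc (norm t)\<bar>\<^sup>2 \<le> (1 / norm t)\<^sup>2"
        using sinc_bounds(2)[OF t] by (intro power_mono) auto
      then have "ennreal ((sinc (norm t))\<^sup>2) \<le> ennreal (1 / norm t ^ Suc 1)"
        by (intro ennreal_leI) (simp only: power2_abs power_divide one_power2 Suc_1)
      also have "\<dots> = ennreal (1 / norm t ^ Suc 1) * indicator {R..} (norm t)"
        using False by simp
      also have "\<dots> \<le> ennreal ((f t)\<^sup>2) + (ennreal (2 * \<kappa>) * indicator {0..R} (norm t) + ennreal (1 / norm t ^ Suc 1) * indicator {R..} (norm t))"
        by (intro order_trans[OF _ add_increasing] order_refl add_increasing) auto
      finally show ?thesis .
    qed
  qed
  also have "\<dots> = ?I + ((\<integral>\<^sup>+ t. ennreal (2 * \<kappa>) * indicator {0..R} (norm t) \<partial>ray_measure) + (\<integral>\<^sup>+ t. ennreal (1 / norm t ^ Suc 1) * indicator {R..} (norm t) \<partial>ray_measure))"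
    by (simp add: nn_integral_add)
  also have "(\<integral>\<^sup>+ t. ennreal (2 * \<kappa>) * indicator {0..R} (norm t) \<partial>ray_measure) = ennreal (2 * \<kappa>) * ennreal R"
    using R_ge by (intro nn_integral_indicator_norm) simp
  also have "(\<integral>\<^sup>+ t. ennreal (1 / norm t ^ Suc 1) * indicator {R..} (norm t) \<partial>ray_measure) = (\<integral>\<^sup>+ r. ennreal (1 / r ^ Suc 1) * indicator {R..} r * indicator {0<..} r \<partial>lborel)"
    by (rule nn_integral_ray_measure_radial) measurable
  also have "\<dots> = (\<integral>\<^sup>+ r. ennreal (1 / r ^ Suc 1) * indicator {R..} r \<partial>lborel)"
    using R_ge by (intro nn_integral_cong) (auto simp: indicator_def)
  also have "\<dots> = ennreal (1 / R)"
    using R_ge by (subst nn_integral_inverse_power_tail) auto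
  also have "ennreal (2 * \<kappa>) * ennreal R + ennreal (1 / R) = ennreal (2 * (\<kappa> * R) + 1 / R)"
    using \<kappa> R_ge by (simp add: ennreal_mult[symmetric] ennreal_plus[symmetric] del: ennreal_plus)
  finally have "ennreal (pi / 2) \<le> ?I + ennreal (2 * (\<kappa> * R) + 1 / R)" .
  also have "\<dots> \<le> ?I + ennreal (11 / 10000)"
  proof (intro add_left_mono ennreal_leI)
    have "1 / R \<le> 1 / 1000" using R_ge by (intro divide_left_mono) auto
    then show "2 * (\<kappa> * R) + 1 / R \<le> 11 / 10000" using \<kappa>(2) by simp
  qed
  finally show ?thesis
    using pi_approx by (cases ?I) (auto simp: ennreal_plus[symmetric] simp del: ennreal_plus)
qed

lemma f_cubed_head: "(\<integral>\<^sup>+ t. ennreal (f t ^ 3) * indicator {0..pi} (norm t) \<partial>ray_measure) \<le> ennreal (11899 / 10000)"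
proof -
  have "(\<integral>\<^sup>+ t. ennreal (f t ^ 3) * indicator {0..pi} (norm t) \<partial>ray_measure) \<le>
    (\<integral>\<^sup>+ t. ennreal (\<bar>sinc (norm t)\<bar> ^ 3) * indicator {0..pi} (norm t) + ennreal (3 * \<kappa>) * indicator {0..pi} (norm t) \<partial>ray_measure)"
  proof (intro nn_integral_mono)
    fix t :: "real ^ 3"
    show "ennreal (f t ^ 3) * indicator {0..pi} (norm t) \<le> ennreal (\<bar>sinc (norm t)\<bar> ^ 3) * indicator {0..pi} (norm t) + ennreal (3 * \<kappa>) * indicator {0..pi} (norm t)"
    proof (cases "norm t \<le> pi")
      case True
      then have "norm t \<le> R" using R_ge pi_less_4 by linarith
      then have "ennreal (f t ^ 3) \<le> ennreal (\<bar>sinc (norm t)\<bar> ^ 3) + ennreal (3 * \<kappa>)"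
        by (rule f_cubed_near)
      with True show ?thesis by simp
    qed simp
  qed
  also have "\<dots> = (\<integral>\<^sup>+ t. ennreal (\<bar>sinc (norm t)\<bar> ^ 3) * indicator {0..pi} (norm t) \<partial>ray_measure) + (\<integral>\<^sup>+ t. ennreal (3 * \<kappa>) * indicator {0..pi} (norm t) \<partial>ray_measure)"
    by (intro nn_integral_add) measurable
  also have "(\<integral>\<^sup>+ t. ennreal (3 * \<kappa>) * indicator {0..pi} (norm t) \<partial>ray_measure) = ennreal (3 * \<kappa>) * ennreal pi"
    by (intro nn_integral_indicator_norm) simp
  also have "(\<integral>\<^sup>+ t. ennreal (\<bar>sinc (norm t)\<bar> ^ 3) * indicator {0..pi} (norm t) \<partial>ray_measure) =
      (\<integral>\<^sup>+ r. ennreal (\<bar>sinc r\<bar> ^ 3) * indicator {0..pi} r * indicator {0<..} r \<partial>lborel)"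
    by (rule nn_integral_ray_measure_radial) measurable
  also have "\<dots> \<le> (\<integral>\<^sup>+ r. ennreal (\<bar>sinc r\<bar> ^ 3) * indicator {0..pi} r \<partial>lborel)"
    by (intro nn_integral_mono) (simp add: indicator_def)
  also have "\<dots> \<le> ennreal (11898 / 10000)"
    by (rule nn_integral_sinc_cubed_head)
  also have "ennreal (11898 / 10000) + ennreal (3 * \<kappa>) * ennreal pi = ennreal (11898 / 10000 + 3 * \<kappa> * pi)"
    using \<kappa> by (simp add: ennreal_mult[symmetric] ennreal_plus[symmetric] del: ennreal_plus)
  also have "\<dots> \<le> ennreal (11899 / 10000)"
  proof (intro ennreal_leI)
    have "\<kappa> * pi \<le> 1 / 10 ^ 20 * 4" using \<kappa> pi_less_4 by (intro mult_mono) auto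
    then show "11898 / 10000 + 3 * \<kappa> * pi \<le> 11899 / 10000" by simp
  qed
  finally show ?thesis by (simp add: add_right_mono)
qed

text \<open>Nearly all of the bound is the \<open>sinc\<close> part
  \<open>1 / (4 * pi\<^sup>2)\<close>, about 0.02533. Comparison up to \<open>R\<close> and decay
  beyond it add less than \<open>10 ^ (- 6)\<close>.\<close>

lemma f_cubed_tail: "(\<integral>\<^sup>+ t. ennreal (f t ^ 3) * indicator {pi..} (norm t) \<partial>ray_measure) \<le> ennreal (2534 / 100000)"
proof -
  have "(\<integral>\<^sup>+ t. ennreal (f t ^ 3) * indicator {pi..} (norm t) \<partial>ray_measure) \<le>
    (\<integral>\<^sup>+ t. ennreal (\<bar>sinc (norm t)\<bar> ^ 3) * indicator {pi..} (norm t) + (ennreal (3 * \<kappa>) * indicator {0..R} (norm t) + ennreal (C ^ 3 / norm t ^ Suc 2) * indicator {R..} (norm t)) \<partial>ray_measure)"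
  proof (intro nn_integral_mono)
    fix t :: "real ^ 3"
    show "ennreal (f t ^ 3) * indicator {pi..} (norm t) \<le> ennreal (\<bar>sinc (norm t)\<bar> ^ 3) * indicator {pi..} (norm t) + (ennreal (3 * \<kappa>) * indicator {0..R} (norm t) + ennreal (C ^ 3 / norm t ^ Suc 2) * indicator {R..} (norm t))"
    proof (cases "pi \<le> norm t")
      case pi: True
      show ?thesis
      proof (cases "norm t \<le> R")
        case True
        have "ennreal (f t ^ 3) \<le> ennreal (\<bar>sinc (norm t)\<bar> ^ 3) + ennreal (3 * \<kappa>)"
          by (rule f_cubed_near[OF True])
        also have "\<dots> \<le> ennreal (\<bar>sinc (norm t)\<bar> ^ 3) + (ennreal (3 * \<kappa>) * indicator {0..R} (norm t) + ennreal (C ^ 3 / norm t ^ Suc 2) * indicator {R..} (norm t))"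
          using True by (intro add_left_mono) simp
        finally show ?thesis using pi by simp
      next
        case False
        then have t: "0 < norm t" using R_ge by linarith
        have "f t ^ 3 \<le> (C / norm t) ^ 3"
          using f_decay[of t] t f_nonneg by (intro power_mono) auto
        then have "ennreal (f t ^ 3) \<le> ennreal (C ^ 3 / norm t ^ Suc 2)"
          by (intro ennreal_leI) (simp add: power_divide eval_nat_numeral)
        also have "\<dots> = ennreal (C ^ 3 / norm t ^ Suc 2) * indicator {R..} (norm t)"
          using False by simp
        also have "\<dots> \<le> ennreal (\<bar>sinc (norm t)\<bar> ^ 3) * indicator {pi..} (norm t) + (ennreal (3 * \<kappa>) * indicator {0..R} (norm t) + ennreal (C ^ 3 / norm t ^ Suc 2) * indicator {R..} (norm t))"
          by (intro order_trans[OF _ add_increasing] order_refl add_increasing) auto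
        finally show ?thesis using pi by simp
      qed
    qed simp
  qed
  also have "\<dots> = (\<integral>\<^sup>+ t. ennreal (\<bar>sinc (norm t)\<bar> ^ 3) * indicator {pi..} (norm t) \<partial>ray_measure) + ((\<integral>\<^sup>+ t. ennreal (3 * \<kappa>) * indicator {0..R} (norm t) \<partial>ray_measure) + (\<integral>\<^sup>+ t. ennreal (C ^ 3 / norm t ^ Suc 2) * indicator {R..} (norm t) \<partial>ray_measure))"
    by (simp add: nn_integral_add)
  also have "(\<integral>\<^sup>+ t. ennreal (3 * \<kappa>) * indicator {0..R} (norm t) \<partial>ray_measure) = ennreal (3 * \<kappa>) * ennreal R"
    using R_ge by (intro nn_integral_indicator_norm) simp
  also have "(\<integral>\<^sup>+ t. ennreal (C ^ 3 / norm t ^ Suc 2) * indicator {R..} (norm t) \<partial>ray_measure) = (\<integral>\<^sup>+ r. ennreal (C ^ 3 / r ^ Suc 2) * indicator {R..} r * indicator {0<..} r \<partial>lborel)"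
    by (rule nn_integral_ray_measure_radial) measurable
  also have "\<dots> = (\<integral>\<^sup>+ r. ennreal (C ^ 3 / r ^ Suc 2) * indicator {R..} r \<partial>lborel)"
    using R_ge by (intro nn_integral_cong) (auto simp: indicator_def)
  also have "\<dots> = ennreal (C ^ 3 / (2 * R\<^sup>2))"
    using R_ge C by (subst nn_integral_inverse_power_tail) auto
  also have "(\<integral>\<^sup>+ t. ennreal (\<bar>sinc (norm t)\<bar> ^ 3) * indicator {pi..} (norm t) \<partial>ray_measure) =
      (\<integral>\<^sup>+ r. ennreal (\<bar>sinc r\<bar> ^ 3) * indicator {pi..} r * indicator {0<..} r \<partial>lborel)"
    by (rule nn_integral_ray_measure_radial) measurable
  also have "\<dots> \<le> (\<integral>\<^sup>+ r. ennreal (\<bar>sinc r\<bar> ^ 3) * indicator {pi..} r \<partial>lborel)"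
    by (intro nn_integral_mono) (simp add: indicator_def)
  also have "\<dots> \<le> ennreal (1 / (4 * pi\<^sup>2))"
    by (rule nn_integral_sinc_cubed_tail)
  also have "ennreal (1 / (4 * pi\<^sup>2)) + (ennreal (3 * \<kappa>) * ennreal R + ennreal (C ^ 3 / (2 * R\<^sup>2))) = ennreal (1 / (4 * pi\<^sup>2) + (3 * (\<kappa> * R) + C ^ 3 / (2 * R\<^sup>2)))"
    using \<kappa> R_ge C by (simp add: ennreal_mult[symmetric] ennreal_plus[symmetric] del: ennreal_plus)
  also have "\<dots> \<le> ennreal (2534 / 100000)"
  proof (intro ennreal_leI)
    have "(3.14159::real)\<^sup>2 \<le> pi\<^sup>2" using pi_approx by (intro power_mono) auto
    then have "1 / (4 * pi\<^sup>2) \<le> 1 / (4 * 3.14159\<^sup>2)" by (intro divide_left_mono) auto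
    moreover have "C ^ 3 / (2 * R\<^sup>2) = 1 / (2000000 * C)"
      using C by (simp add: R_def field_simps eval_nat_numeral)
    moreover have "1 / (2000000 * C) \<le> 1 / 2000000"
      using C by (intro divide_left_mono) auto
    ultimately show "1 / (4 * pi\<^sup>2) + (3 * (\<kappa> * R) + C ^ 3 / (2 * R\<^sup>2)) \<le> 2534 / 100000"
      using \<kappa>(2) by (simp add: power2_eq_square)
  qed
  finally show ?thesis by (simp add: add_right_mono)
qed

text \<open>The constant \<open>exp (- 1 / 4)\<close> is what the interpolation for \<open>2 \<le> s \<le> 3\<close> below needs: with
  \<open>l = s - 2\<close> it gives \<open>sqrt s * exp (- l / 4) \<le> sqrt 2\<close>.\<close>
lemma f_cubed:
  "(\<integral>\<^sup>+ t. ennreal (f t ^ 3) \<partial>ray_measure) \<le> ennreal (exp (- 1 / 4)) * (\<integral>\<^sup>+ t. ennreal ((f t)\<^sup>2) \<partial>ray_measure)"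
proof -
  have "(\<integral>\<^sup>+ t. ennreal (f t ^ 3) \<partial>ray_measure) \<le> (\<integral>\<^sup>+ t. ennreal (f t ^ 3) * indicator {0..pi} (norm t) + ennreal (f t ^ 3) * indicator {pi..} (norm t) \<partial>ray_measure)"
    by (intro nn_integral_mono) (auto simp: indicator_def)
  also have "\<dots> = (\<integral>\<^sup>+ t. ennreal (f t ^ 3) * indicator {0..pi} (norm t) \<partial>ray_measure) + (\<integral>\<^sup>+ t. ennreal (f t ^ 3) * indicator {pi..} (norm t) \<partial>ray_measure)"
    by (intro nn_integral_add) measurable
  also have "\<dots> \<le> ennreal (11899 / 10000) + ennreal (2534 / 100000)"
    by (intro add_mono f_cubed_head f_cubed_tail)
  \<comment> \<open>The rational number \<open>777 / 1000\<close> separates the ratio of the two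
    integrals, at most about 0.7746, from \<open>exp (- 1 / 4)\<close>, about 0.7788.\<close>
  also have "\<dots> \<le> ennreal (777 / 1000 * (1569 / 1000))"
    by (simp add: ennreal_plus[symmetric] del: ennreal_plus)
  also have "\<dots> \<le> ennreal (exp (- 1 / 4) * (1569 / 1000))"
  proof (intro ennreal_leI mult_right_mono)
    have "(777 / 1000 :: real) \<le> (1 + (- 1 / 4) / 16) ^ 16"
      by (simp add: power_divide)
    also have "\<dots> \<le> exp (- 1 / 4)"
      using exp_ge_one_plus_x_over_n_power_n[of 16 "- 1 / 4"] by simp
    finally show "777 / 1000 \<le> exp (- 1 / 4 :: real)" .
  qed simp
  also have "\<dots> \<le> ennreal (exp (- 1 / 4)) * (\<integral>\<^sup>+ t. ennreal ((f t)\<^sup>2) \<partial>ray_measure)"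
    using f_squared_lower by (subst ennreal_mult) (simp_all add: mult_left_mono)
  finally show ?thesis .
qed

text \<open>Log-convexity is used pointwise: \<open>f t powr s\<close> is the geometric mean of
  \<open>(f t)\<^sup>2\<close> and \<open>f t ^ 3\<close> with weights \<open>1 - l\<close> and
  \<open>l\<close>. Young's inequality makes it a linear combination, so the integrals are compared
  without assuming that they are finite.\<close>

lemma le_scaled_squares_small:
  assumes s: "2 \<le> s" "s \<le> 3"
  shows "ennreal (sqrt s) * (\<integral>\<^sup>+ t. ennreal (f t powr s) \<partial>ray_measure) \<le> ennreal (sqrt 2) * (\<integral>\<^sup>+ t. ennreal ((f t)\<^sup>2) \<partial>ray_measure)"
proof -
  let ?I = "\<integral>\<^sup>+ t. ennreal ((f t)\<^sup>2) \<partial>ray_measure"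
  define l where "l = s - 2"
  have l: "0 \<le> l" "l \<le> 1" using s by (auto simp: l_def)
  define k :: real where "k = exp (- 1 / 4)"
  have k: "0 < k" by (simp add: k_def)
  \<comment> \<open>Dividing the cube by \<open>k\<close> before applying Young's inequality
    balances the terms: as the cube integrates to at most \<open>k * ?I\<close>, the two
    contributions add up to \<open>k powr l * ?I\<close>.\<close>
  have pw: "f t powr s \<le> k powr l * (1 - l) * (f t)\<^sup>2 + k powr l * l / k * f t ^ 3" for t
  proof (cases "f t = 0")
    case False
    then have ft: "0 < f t" using f_nonneg[of t] by simp
    have "f t powr s = f t powr (2 * (1 - l) + 3 * l)"
      by (simp add: l_def algebra_simps)
    also have "\<dots> = (f t powr 2) powr (1 - l) * (f t powr 3) powr l"
      by (simp only: powr_add powr_powr)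
    also have "\<dots> = ((f t)\<^sup>2) powr (1 - l) * (f t ^ 3) powr l"
      using ft by simp
    also have "\<dots> = k powr l * (((f t)\<^sup>2) powr (1 - l) * (f t ^ 3 / k) powr l)"
      using ft k by (simp add: powr_divide)
    also have "\<dots> \<le> k powr l * ((1 - l) * (f t)\<^sup>2 + l * (f t ^ 3 / k))"
      using l ft k by (intro mult_left_mono Youngs_inequality_weak) auto
    finally show ?thesis by (simp add: algebra_simps)
  qed (use l in auto)
  have "(\<integral>\<^sup>+ t. ennreal (f t powr s) \<partial>ray_measure) \<le> (\<integral>\<^sup>+ t. ennreal (k powr l * (1 - l)) * ennreal ((f t)\<^sup>2) + ennreal (k powr l * l / k) * ennreal (f t ^ 3) \<partial>ray_measure)"
  proof (intro nn_integral_mono)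
    fix t
    have "ennreal (f t powr s) \<le> ennreal (k powr l * (1 - l) * (f t)\<^sup>2 + k powr l * l / k * f t ^ 3)"
      by (intro ennreal_leI pw)
    also have "\<dots> = ennreal (k powr l * (1 - l)) * ennreal ((f t)\<^sup>2) + ennreal (k powr l * l / k) * ennreal (f t ^ 3)"
      using l k f_nonneg[of t] by (subst ennreal_plus) (simp_all add: ennreal_mult'[symmetric])
    finally show "ennreal (f t powr s) \<le> \<dots>" .
  qed
  also have "\<dots> = ennreal (k powr l * (1 - l)) * ?I + ennreal (k powr l * l / k) * (\<integral>\<^sup>+ t. ennreal (f t ^ 3) \<partial>ray_measure)"
    by (simp add: nn_integral_add nn_integral_cmult)
  also have "\<dots> \<le> ennreal (k powr l * (1 - l)) * ?I + ennreal (k powr l * l / k) * (ennreal k * ?I)"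
    using f_cubed by (intro add_left_mono mult_left_mono) (auto simp: k_def)
  also have "\<dots> = (ennreal (k powr l * (1 - l)) + ennreal (k powr l * l / k) * ennreal k) * ?I"
    by (simp add: algebra_simps)
  also have "ennreal (k powr l * (1 - l)) + ennreal (k powr l * l / k) * ennreal k = ennreal (k powr l)"
    using l k by (simp add: ennreal_mult[symmetric] ennreal_plus[symmetric] algebra_simps del: ennreal_plus)
  finally have "ennreal (sqrt s) * (\<integral>\<^sup>+ t. ennreal (f t powr s) \<partial>ray_measure) \<le> ennreal (sqrt s) * (ennreal (k powr l) * ?I)"
    by (intro mult_left_mono) auto
  also have "\<dots> = ennreal (sqrt s * k powr l) * ?I"
    using s by (simp add: ennreal_mult mult.assoc)
  also have "\<dots> \<le> ennreal (sqrt 2) * ?I"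
  proof (intro mult_right_mono ennreal_leI)
    \<comment> \<open>The tangent to the exponential at \<open>l = 0\<close>, that is, at
      \<open>s = 2\<close>, where the final inequality is sharp.\<close>
    have "s \<le> 2 * exp (l / 2)"
    proof -
      have "s = 2 * (1 + l / 2)" by (simp add: l_def field_simps)
      also have "\<dots> \<le> 2 * exp (l / 2)"
        by (intro mult_left_mono exp_ge_add_one_self) simp
      finally show ?thesis .
    qed
    then have "sqrt s \<le> sqrt (2 * (exp (l / 4))\<^sup>2)"
      by (intro real_sqrt_le_mono) (simp add: power2_eq_square flip: exp_add)
    also have "\<dots> = sqrt 2 * exp (l / 4)"
      by (simp add: real_sqrt_mult)
    finally have "sqrt s * k powr l \<le> sqrt 2 * exp (l / 4) * k powr l"
      by (intro mult_right_mono) auto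
    also have "\<dots> = sqrt 2"
      by (simp add: k_def powr_def flip: exp_add)
    finally show "sqrt s * k powr l \<le> sqrt 2" .
  qed simp
  finally show ?thesis .
qed

text \<open>For exponents \<open>s \<ge> 3\<close> this supplies the factor
  \<open>(1 / 2) powr (s - 3)\<close> on the tail, which absorbs the growth of
  \<open>sqrt s\<close>.\<close>

lemma f_le_half:
  assumes "pi \<le> norm t"
  shows "f t \<le> 1 / 2"
proof (cases "norm t \<le> R")
  case True
  have t: "3 < norm t" using assms pi_gt3 by linarith
  have "\<bar>sinc (norm t)\<bar> \<le> 1 / norm t"
    by (rule sinc_bounds(2)) (use t in linarith)
  also have "\<dots> \<le> 1 / 3"
    using t by (intro divide_left_mono) auto
  finally have "\<bar>sinc (norm t)\<bar> \<le> 1 / 3" .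
  moreover have "\<kappa> \<le> 1 / 6" using \<kappa>(3) by simp
  ultimately show ?thesis using near(1)[OF True] by linarith
next
  case False
  then have t: "0 < norm t" "R \<le> norm t" using R_ge by linarith+
  have "f t \<le> C / norm t" using t by (intro f_decay) auto
  also have "\<dots> \<le> C / R" using t C R_ge by (intro divide_left_mono) auto
  also have "\<dots> = 1 / (1000 * C)" using C by (simp add: R_def power2_eq_square)
  also have "\<dots> \<le> 1 / 2" using C by (intro divide_left_mono) auto
  finally show ?thesis .
qed

text \<open>On this range \<open>exp (- r\<^sup>2 / 6) \<ge> 1 / 9\<close>, so the error
  \<open>d * r\<^sup>2\<close> is at most \<open>r\<^sup>2 / 60000\<close> times the Gaussian. As
  \<open>1 + x \<le> exp x\<close>, it only lowers the rate from \<open>1 / 6\<close> to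
  \<open>1 / 6 - 1 / 60000 = 9999 / 60000\<close>.\<close>

lemma f_le_exp:
  assumes t: "0 < norm t" "norm t \<le> pi"
  shows "f t \<le> exp (- (9999 / 60000 * (norm t)\<^sup>2))"
proof -
  let ?r = "norm t"
  have "?r\<^sup>2 \<le> (3.1416)\<^sup>2" using t pi_approx by (intro power_mono) auto
  then have "?r\<^sup>2 / 6 \<le> 2" by (simp add: power2_eq_square)
  then have "exp (?r\<^sup>2 / 6) \<le> exp (1 + 1)" by simp
  also have "\<dots> \<le> 3 * 3" unfolding exp_add using exp_le by (intro mult_mono) auto
  finally have "1 / 9 \<le> exp (- ?r\<^sup>2 / 6)" by (simp add: exp_minus field_simps)
  then have *: "1 / 9 * (?r\<^sup>2 / 60000) \<le> exp (- ?r\<^sup>2 / 6) * (?r\<^sup>2 / 60000)"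
    by (intro mult_right_mono) auto
  have "d \<le> 1 / (10 ^ 30 * 1)"
    using d C by (elim order_trans) (intro divide_left_mono mult_left_mono one_le_power, auto)
  then have "d * ?r\<^sup>2 \<le> 1 / 540000 * ?r\<^sup>2" by (intro mult_right_mono) auto
  moreover have "\<bar>sinc ?r\<bar> = sinc ?r"
    using t by (intro abs_of_nonneg) (auto intro!: divide_nonneg_pos sin_ge_zero)
  ultimately have "f t \<le> exp (- ?r\<^sup>2 / 6) + exp (- ?r\<^sup>2 / 6) * (?r\<^sup>2 / 60000)"
    using f_close[of t] sinc_le_exp[OF t] * by linarith
  also have "\<dots> = exp (- ?r\<^sup>2 / 6) * (1 + ?r\<^sup>2 / 60000)"
    by (simp add: algebra_simps)
  also have "\<dots> \<le> exp (- ?r\<^sup>2 / 6) * exp (?r\<^sup>2 / 60000)"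
    using exp_ge_add_one_self[of "?r\<^sup>2 / 60000"] by (intro mult_left_mono) auto
  also have "\<dots> = exp (- (9999 / 60000 * ?r\<^sup>2))"
    by (simp flip: exp_add)
  finally show ?thesis .
qed

text \<open>Inside radius \<open>pi\<close> the Gaussian integral is a multiple of
  \<open>1 / sqrt s\<close>, so multiplying by \<open>sqrt s\<close> gives a constant independent of
  \<open>s\<close>. The tail, multiplied by \<open>sqrt s\<close>, is bounded by its value at
  \<open>s = 3\<close>.\<close>

lemma le_scaled_squares_large:
  assumes s: "3 \<le> s"
  shows "ennreal (sqrt s) * (\<integral>\<^sup>+ t. ennreal (f t powr s) \<partial>ray_measure) \<le> ennreal (sqrt 2) * (\<integral>\<^sup>+ t. ennreal ((f t)\<^sup>2) \<partial>ray_measure)"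
proof -
  let ?b = "s * (9999 / 60000)"
  let ?q = "(1 / 2) powr (s - 3) :: real"
  have "(\<integral>\<^sup>+ t. ennreal (f t powr s) \<partial>ray_measure) \<le>
    (\<integral>\<^sup>+ t. ennreal (exp (- (?b * (norm t)\<^sup>2))) + ennreal ?q * (ennreal (f t ^ 3) * indicator {pi..} (norm t)) \<partial>ray_measure)"
  proof (intro nn_integral_mono)
    fix t :: "real ^ 3"
    show "ennreal (f t powr s) \<le> ennreal (exp (- (?b * (norm t)\<^sup>2))) + ennreal ?q * (ennreal (f t ^ 3) * indicator {pi..} (norm t))"
    proof (cases "pi \<le> norm t")
      case True
      have "f t powr s \<le> ?q * f t ^ 3"
      proof (cases "f t = 0")
        case False
        then have ft: "0 < f t" using f_nonneg[of t] by simp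
        have "f t powr s = f t powr ((s - 3) + 3)" by simp
        also have "\<dots> = f t powr (s - 3) * f t ^ 3"
          using ft by (simp only: powr_add) simp
        also have "\<dots> \<le> ?q * f t ^ 3"
          using ft s f_le_half[OF True] by (intro mult_right_mono powr_mono2) auto
        finally show ?thesis .
      qed auto
      then have "ennreal (f t powr s) \<le> ennreal ?q * ennreal (f t ^ 3)"
        by (simp add: ennreal_mult'[symmetric] ennreal_leI)
      with True show ?thesis by (simp add: add_increasing)
    next
      case False
      have "f t powr s \<le> exp (- (?b * (norm t)\<^sup>2))"
      proof (cases "t = 0")
        case True
        then show ?thesis using f_le_1[of t] f_nonneg[of t] s by (simp add: powr_le1)
      next
        case t: False
        have "f t powr s \<le> exp (- (9999 / 60000 * (norm t)\<^sup>2)) powr s"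
          using t False f_nonneg s by (intro powr_mono2 f_le_exp) auto
        also have "\<dots> = exp (- (?b * (norm t)\<^sup>2))"
          by (simp add: powr_def algebra_simps)
        finally show ?thesis .
      qed
      with False show ?thesis by (simp add: ennreal_leI)
    qed
  qed
  also have "\<dots> = (\<integral>\<^sup>+ t. ennreal (exp (- (?b * (norm t)\<^sup>2))) \<partial>ray_measure) + ennreal ?q * (\<integral>\<^sup>+ t. ennreal (f t ^ 3) * indicator {pi..} (norm t) \<partial>ray_measure)"
    by (simp add: nn_integral_add nn_integral_cmult)
  also have "(\<integral>\<^sup>+ t. ennreal (exp (- (?b * (norm t)\<^sup>2))) \<partial>ray_measure) = (\<integral>\<^sup>+ r. ennreal (exp (- (?b * r\<^sup>2))) * indicator {0<..} r \<partial>lborel)"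
    by (rule nn_integral_ray_measure_radial) measurable
  also have "\<dots> = ennreal (sqrt (pi / ?b) / 2)"
    using s by (intro nn_integral_exp_square) simp
  finally have "ennreal (sqrt s) * (\<integral>\<^sup>+ t. ennreal (f t powr s) \<partial>ray_measure) \<le>
    ennreal (sqrt s) * (ennreal (sqrt (pi / ?b) / 2) + ennreal ?q * ennreal (2534 / 100000))"
    using f_cubed_tail by (intro mult_left_mono) (auto elim!: order_trans intro!: add_left_mono mult_left_mono)
  also have "\<dots> = ennreal (sqrt s * (sqrt (pi / ?b) / 2) + sqrt s * ?q * (2534 / 100000))"
    using s by (simp add: ennreal_mult[symmetric] ennreal_plus[symmetric] algebra_simps del: ennreal_plus)
  also have "\<dots> \<le> ennreal (sqrt 2 * (1569 / 1000))"
  proof (intro ennreal_leI)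
    have "sqrt s * sqrt (pi / ?b) = sqrt (60000 / 9999 * pi)"
      using s by (simp add: real_sqrt_mult[symmetric])
    also have "\<dots> \<le> sqrt (4.344\<^sup>2)"
      using pi_approx by (intro real_sqrt_le_mono) (simp add: power2_eq_square)
    finally have main: "sqrt s * (sqrt (pi / ?b) / 2) \<le> 2172 / 1000" by simp
    \<comment> \<open>The aim is \<open>s / 3 \<le> 4 powr (s - 3)\<close>, whose square root gives
      \<open>sqrt s * ?q \<le> sqrt 3\<close>.\<close>
    have "s / 3 \<le> 1 + (s - 3) * (1 / 3)" by (simp add: field_simps)
    also have "\<dots> \<le> exp ((s - 3) * (1 / 3))" by (rule exp_ge_add_one_self)
    also have "\<dots> \<le> exp ((s - 3) * (2 * ln 2))"
      using s ln2_ge_two_thirds by (intro exp_le_cancel_iff[THEN iffD2] mult_left_mono) auto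
    finally have "s \<le> 3 * (2 powr (s - 3))\<^sup>2"
      by (simp add: powr_def power2_eq_square algebra_simps flip: exp_add)
    then have "sqrt s \<le> sqrt (3 * (2 powr (s - 3))\<^sup>2)"
      by (rule real_sqrt_le_mono)
    then have "sqrt s \<le> sqrt 3 * 2 powr (s - 3)"
      by (simp add: real_sqrt_mult)
    then have "sqrt s * ?q \<le> sqrt 3 * 2 powr (s - 3) * ?q"
      by (intro mult_right_mono) auto
    also have "\<dots> = sqrt 3" by (simp add: powr_divide)
    also have "\<dots> \<le> 17321 / 10000" by (rule real_le_lsqrt) (auto simp: power2_eq_square)
    finally have tail: "sqrt s * ?q \<le> 17321 / 10000" .
    have "14142 / 10000 \<le> sqrt 2" by (rule real_le_rsqrt) (simp add: power2_eq_square)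
    \<comment> \<open>Numerically about 2.2159 against 2.2188; this small margin fixes the precision
      of the preceding constants.\<close>
    with main tail show "sqrt s * (sqrt (pi / ?b) / 2) + sqrt s * ?q * (2534 / 100000) \<le> sqrt 2 * (1569 / 1000)"
      by linarith
  qed
  also have "\<dots> \<le> ennreal (sqrt 2) * (\<integral>\<^sup>+ t. ennreal ((f t)\<^sup>2) \<partial>ray_measure)"
    using f_squared_lower by (subst ennreal_mult) (simp_all add: mult_left_mono)
  finally show ?thesis .
qed

lemma le_scaled_squares:
  assumes "2 \<le> s"
  shows "ennreal (sqrt s) * (\<integral>\<^sup>+ t. ennreal (f t powr s) \<partial>ray_measure) \<le> ennreal (sqrt 2) * (\<integral>\<^sup>+ t. ennreal ((f t)\<^sup>2) \<partial>ray_measure)"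
  using le_scaled_squares_small[OF assms] le_scaled_squares_large[of s] by (cases "s \<le> 3") auto

end

section \<open>Characteristic functions\<close>

text \<open>Weighted AM-GM with zeros allowed. After division by the mean \<open>m\<close>, each
  factor is at most \<open>exp (w j * (u j / m - 1))\<close>, and these exponents sum to 0. If
  \<open>m = 0\<close>, some \<open>u i\<close> of positive weight is 0 and so is the
  product.\<close>

lemma prod_powr_le_sum:
  fixes u w :: "'i \<Rightarrow> real"
  assumes J: "finite J" and w: "\<And>j. j \<in> J \<Longrightarrow> 0 \<le> w j" "(\<Sum>j\<in>J. w j) = 1" and u: "\<And>j. j \<in> J \<Longrightarrow> 0 \<le> u j"
  shows "(\<Prod>j\<in>J. u j powr w j) \<le> (\<Sum>j\<in>J. w j * u j)"
proof -
  define m where "m = (\<Sum>j\<in>J. w j * u j)"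
  have m0: "0 \<le> m" unfolding m_def using w u by (intro sum_nonneg) auto
  show ?thesis
  proof (cases "m = 0")
    case True
    then have zero: "w j * u j = 0" if "j \<in> J" for j
      using sum_nonneg_eq_0_iff[OF J, of "\<lambda>j. w j * u j"] w u that by (auto simp: m_def)
    obtain i where "i \<in> J" "w i \<noteq> 0"
      using w(2) by (metis sum.neutral zero_neq_one)
    then have "u i powr w i = 0" using zero[of i] by simp
    then have "(\<Prod>j\<in>J. u j powr w j) = 0"
      using J \<open>i \<in> J\<close> by (intro prod_zero) auto
    then show ?thesis using m0 by (simp add: m_def)
  next
    case False
    with m0 have m: "0 < m" by simp
    have "(\<Prod>j\<in>J. u j powr w j) = (\<Prod>j\<in>J. (u j / m) powr w j * m powr w j)"
      using u m by (intro prod.cong) (auto simp: powr_divide)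
    also have "\<dots> = (\<Prod>j\<in>J. (u j / m) powr w j) * m powr (\<Sum>j\<in>J. w j)"
      using m by (simp add: prod.distrib powr_sum)
    also have "(\<Prod>j\<in>J. (u j / m) powr w j) \<le> (\<Prod>j\<in>J. exp (w j * (u j / m - 1)))"
    proof (intro prod_mono conjI)
      fix j assume j: "j \<in> J"
      have "u j / m \<le> exp (u j / m - 1)"
        using exp_ge_add_one_self[of "u j / m - 1"] by simp
      then have "(u j / m) powr w j \<le> exp (u j / m - 1) powr w j"
        using u w m j by (intro powr_mono2) auto
      also have "\<dots> = exp (w j * (u j / m - 1))" by (simp add: powr_def)
      finally show "(u j / m) powr w j \<le> exp (w j * (u j / m - 1))" .
    qed auto
    also have "\<dots> = exp (\<Sum>j\<in>J. w j * (u j / m - 1))"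
      using J by (simp add: exp_sum)
    also have "(\<Sum>j\<in>J. w j * (u j / m - 1)) = (\<Sum>j\<in>J. w j * u j) / m - (\<Sum>j\<in>J. w j)"
      by (simp add: sum_subtractf sum_divide_distrib right_diff_distrib)
    also have "\<dots> = 0" using m w(2) by (simp flip: m_def)
    finally show ?thesis using m w(2) by (simp add: m_def)
  qed
qed

text \<open>Keeping both factors \<open>a + b\<close> and \<open>a - b\<close>, instead of the
  Lipschitz bound \<open>\<bar>a - b\<bar>\<close>, yields a difference of second order in
  \<open>t\<close>.\<close>

lemma abs_cos_diff_le: "\<bar>cos a - cos b\<bar> \<le> \<bar>a + b\<bar> * \<bar>a - b\<bar> / 2" for a b :: real
proof -
  have "cos a - cos b = 2 * sin ((a + b) / 2) * sin ((b - a) / 2)"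
    by (rule cos_diff_cos)
  then have "\<bar>cos a - cos b\<bar> = 2 * (\<bar>sin ((a + b) / 2)\<bar> * \<bar>sin ((b - a) / 2)\<bar>)"
    by (simp add: abs_mult)
  also have "\<dots> \<le> 2 * (\<bar>(a + b) / 2\<bar> * \<bar>(b - a) / 2\<bar>)"
    by (intro mult_left_mono mult_mono abs_sin_x_le_abs_x) auto
  finally show ?thesis by (simp add: abs_mult abs_minus_commute mult.commute)
qed

text \<open>As \<open>y\<close> is a unit vector, \<open>norm (x + y)\<close> is at most
  \<open>norm (x - y) + 2\<close>. The resulting linear term in \<open>norm (x - y)\<close> is split
  by AM-GM with parameter \<open>\<delta>\<close>, so that the mean over a coupling involves its
  quadratic cost alone.\<close>

lemma abs_cos_inner_diff_le:
  fixes t x y :: "'a::real_inner"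
  assumes y: "norm y = 1" and \<delta>: "0 < \<delta>"
  shows "\<bar>cos (t \<bullet> x) - cos (t \<bullet> y)\<bar> \<le> (norm t)\<^sup>2 / 2 * ((1 + 1 / \<delta>) * (norm (x - y))\<^sup>2 + \<delta>)"
proof -
  let ?D = "norm (x - y)"
  have "x + y = (x - y) + 2 *\<^sub>R y" by (simp add: scaleR_2)
  also have "norm \<dots> \<le> ?D + norm (2 *\<^sub>R y)" by (rule norm_triangle_ineq)
  also have "norm (2 *\<^sub>R y) = 2" using y by simp
  finally have "norm (x + y) \<le> ?D + 2" .
  then have "\<bar>t \<bullet> x + t \<bullet> y\<bar> \<le> norm t * (?D + 2)"
    using Cauchy_Schwarz_ineq2[of t "x + y"] by (simp add: inner_add_right) (meson mult_left_mono norm_ge_zero order_trans)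
  moreover have "\<bar>t \<bullet> x - t \<bullet> y\<bar> \<le> norm t * ?D"
    using Cauchy_Schwarz_ineq2[of t "x - y"] by (simp add: inner_diff_right)
  ultimately have "\<bar>t \<bullet> x + t \<bullet> y\<bar> * \<bar>t \<bullet> x - t \<bullet> y\<bar> \<le> (norm t * (?D + 2)) * (norm t * ?D)"
    by (intro mult_mono) auto
  with abs_cos_diff_le[of "t \<bullet> x" "t \<bullet> y"] have "\<bar>cos (t \<bullet> x) - cos (t \<bullet> y)\<bar> \<le> (norm t * (?D + 2)) * (norm t * ?D) / 2"
    by simp
  also have "\<dots> = (norm t)\<^sup>2 / 2 * (?D\<^sup>2 + 2 * ?D)"
    by (simp add: power2_eq_square algebra_simps)
  also have "\<dots> \<le> (norm t)\<^sup>2 / 2 * ((1 + 1 / \<delta>) * ?D\<^sup>2 + \<delta>)"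
  proof (intro mult_left_mono)
    have "0 \<le> (?D - \<delta>)\<^sup>2 / \<delta>" using \<delta> by simp
    also have "\<dots> = ?D\<^sup>2 / \<delta> + \<delta> - 2 * ?D"
      using \<delta> by (simp add: power2_eq_square field_simps)
    finally show "?D\<^sup>2 + 2 * ?D \<le> (1 + 1 / \<delta>) * ?D\<^sup>2 + \<delta>"
      by (simp add: algebra_simps)
  qed simp
  finally show ?thesis .
qed

lemma LINT_cos_near_sinc:
  fixes \<mu> :: "(real ^ 3) measure"
  assumes W: "wasserstein2 \<mu> uniform_sphere < ennreal \<delta>" and \<delta>: "0 < \<delta>" "\<delta> \<le> 1"
  shows "\<bar>(LINT x|\<mu>. cos (t \<bullet> x)) - sinc (norm t)\<bar> \<le> 2 * \<delta> * (norm t)\<^sup>2"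
proof -
  interpret U: prob_space "uniform_sphere :: (real^3) measure" by (rule prob_space_uniform_sphere)
  \<comment> \<open>The strict inequality yields a coupling of cost below \<open>\<delta>\<close>;
    the infimum itself need not be attained.\<close>
  obtain \<pi> where \<pi>: "\<pi> \<in> couplings \<mu> uniform_sphere"
    and cost: "ennreal_sqrt (\<integral>\<^sup>+ (x, y). ennreal ((norm (x - y))\<^sup>2) \<partial>\<pi>) < ennreal \<delta>"
    using W unfolding wasserstein2_def INF_less_iff by blast
  have sets [measurable_cong]: "sets \<pi> = sets borel"
    and fst: "distr \<pi> borel fst = \<mu>" and snd: "distr \<pi> borel snd = uniform_sphere"
    using \<pi> by (auto simp: couplings_def)
  have space: "space \<pi> = UNIV" using sets_eq_imp_space_eq[OF sets] by simp
  have meas [measurable]: "fst \<in> borel_measurable \<pi>" "snd \<in> borel_measurable \<pi>"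
    by (simp_all add: measurable_cong_sets[OF sets refl] borel_measurable_continuous_onI continuous_on_fst continuous_on_snd continuous_on_id)
  \<comment> \<open>Membership in \<open>couplings\<close> prescribes the Borel sets and the
    marginals; total mass 1 is inherited from the second marginal.\<close>
  interpret prob_space \<pi>
    by (rule prob_space_distrD[OF meas(2)]) (simp add: snd prob_space_uniform_sphere)
  define D where "D z = (norm (fst z - snd z))\<^sup>2" for z :: "(real^3) \<times> (real^3)"
  have [measurable]: "D \<in> borel_measurable \<pi>"
    unfolding D_def by measurable
  have D0: "0 \<le> D z" for z by (simp add: D_def)
  let ?c = "\<integral>\<^sup>+ z. ennreal (D z) \<partial>\<pi>"
  have "ennreal_sqrt ?c < ennreal \<delta>"
    using cost by (simp add: D_def case_prod_unfold)
  then have c: "?c \<noteq> \<top>" "sqrt (enn2real ?c) < \<delta>"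
    using \<delta> by (auto simp: ennreal_sqrt_def ennreal_less_iff split: if_splits)
  then have int: "integrable \<pi> D"
    using D0 by (intro integrableI_nonneg) (auto simp: top.not_eq_extremum)
  have "(LINT z|\<pi>. D z) = enn2real ?c"
    using D0 by (intro integral_eq_nn_integral) auto
  also have "\<dots> = (sqrt (enn2real ?c))\<^sup>2" by simp
  also have "\<dots> \<le> \<delta>\<^sup>2" using c by (intro power_mono) auto
  finally have ED: "(LINT z|\<pi>. D z) \<le> \<delta>\<^sup>2" .
  have cos1: "(LINT x|\<mu>. cos (t \<bullet> x)) = (LINT z|\<pi>. cos (t \<bullet> fst z))"
    unfolding fst[symmetric] by (rule integral_distr) measurable
  have cos2: "sinc (norm t) = (LINT z|\<pi>. cos (t \<bullet> snd z))"
    unfolding LINT_uniform_sphere_cos[symmetric] snd[symmetric] by (rule integral_distr) measurable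
  have i: "integrable \<pi> (\<lambda>z. cos (t \<bullet> fst z))" "integrable \<pi> (\<lambda>z. cos (t \<bullet> snd z))"
    by (auto intro!: integrable_const_bound[where B=1])
  have "AE z in distr \<pi> borel snd. norm z = 1"
    unfolding snd using AE_uniform_sphere by (auto elim!: eventually_mono)
  then have AE: "AE z in \<pi>. norm (snd z) = 1"
    by (rule AE_distrD[OF meas(2)])
  have "\<bar>(LINT x|\<mu>. cos (t \<bullet> x)) - sinc (norm t)\<bar> = \<bar>LINT z|\<pi>. cos (t \<bullet> fst z) - cos (t \<bullet> snd z)\<bar>"
    unfolding cos1 cos2 using i by simp
  also have "\<dots> \<le> (LINT z|\<pi>. \<bar>cos (t \<bullet> fst z) - cos (t \<bullet> snd z)\<bar>)"
    by (rule integral_abs_bound)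
  also have "\<dots> \<le> (LINT z|\<pi>. (norm t)\<^sup>2 / 2 * ((1 + 1 / \<delta>) * D z + \<delta>))"
  proof (rule integral_mono_AE)
    show "AE z in \<pi>. \<bar>cos (t \<bullet> fst z) - cos (t \<bullet> snd z)\<bar> \<le> (norm t)\<^sup>2 / 2 * ((1 + 1 / \<delta>) * D z + \<delta>)"
      using AE by eventually_elim (unfold D_def, rule abs_cos_inner_diff_le[OF _ \<delta>(1)])
  qed (use i int in auto)
  also have "\<dots> = (norm t)\<^sup>2 / 2 * ((1 + 1 / \<delta>) * (LINT z|\<pi>. D z) + \<delta>)"
    using int by (simp add: prob_space)
  also have "\<dots> \<le> (norm t)\<^sup>2 / 2 * ((1 + 1 / \<delta>) * \<delta>\<^sup>2 + \<delta>)"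
    using ED \<delta> by (intro mult_left_mono add_right_mono) auto
  also have "(1 + 1 / \<delta>) * \<delta>\<^sup>2 + \<delta> = \<delta> * (2 + \<delta>)"
    using \<delta> by (simp add: power2_eq_square field_simps)
  also have "(norm t)\<^sup>2 / 2 * (\<delta> * (2 + \<delta>)) \<le> (norm t)\<^sup>2 / 2 * (\<delta> * 4)"
    using \<delta> by (intro mult_left_mono) auto
  finally show ?thesis by (simp add: mult_ac)
qed

section \<open>Symmetric laws and independent sums\<close>

lemma char_vec_symmetric:
  fixes \<mu> :: "(real ^ 3) measure"
  assumes \<mu>: "prob_space \<mu>" "sets \<mu> = sets borel" and sym: "distr \<mu> borel uminus = \<mu>"
  shows "char_vec \<mu> t = complex_of_real (LINT x|\<mu>. cos (t \<bullet> x))"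
proof -
  interpret prob_space \<mu> by fact
  note \<mu>(2)[measurable_cong]
  have int: "integrable \<mu> (\<lambda>x. iexp (t \<bullet> x))"
    by (intro integrable_const_bound[where B=1]) auto
  have "(LINT x|\<mu>. sin (t \<bullet> x)) = (LINT x|distr \<mu> borel uminus. sin (t \<bullet> x))"
    by (simp add: sym)
  also have "\<dots> = (LINT x|\<mu>. sin (t \<bullet> - x))"
    by (rule integral_distr) measurable
  also have "\<dots> = - (LINT x|\<mu>. sin (t \<bullet> x))" by simp
  finally have "(LINT x|\<mu>. sin (t \<bullet> x)) = 0" by simp
  then show ?thesis
    using int by (simp add: char_vec_def complex_eq_iff integral_Re[symmetric] integral_Im[symmetric] cis_conv_exp[symmetric] mult.commute)
qed

text \<open>Cosines of sums do not factor, so the proof passes to complex exponentials. By symmetry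
  each factor is real, hence the real part of the product is the product of the cosine
  means.\<close>

lemma (in prob_space) LINT_cos_sum_indep:
  fixes X :: "'i \<Rightarrow> 'a \<Rightarrow> real ^ 3" and b :: "'i \<Rightarrow> real"
  assumes I: "finite I" and indep: "indep_vars (\<lambda>_. borel) X I"
    and dist: "\<And>i. i \<in> I \<Longrightarrow> distr M borel (X i) = \<mu>" and sym: "distr \<mu> borel uminus = \<mu>"
  shows "(LINT x|distr M borel (\<lambda>\<omega>. \<Sum>i\<in>I. b i *\<^sub>R X i \<omega>). cos (t \<bullet> x)) = (\<Prod>i\<in>I. LINT x|\<mu>. cos ((b i *\<^sub>R t) \<bullet> x))"
proof -
  have X [measurable]: "X i \<in> borel_measurable M" if "i \<in> I" for i
    using indep that by (auto simp: indep_vars_def)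
  let ?Y = "\<lambda>i \<omega>. iexp (t \<bullet> (b i *\<^sub>R X i \<omega>))"
  have Y: "indep_vars (\<lambda>_. borel) ?Y I"
    by (rule indep_vars_compose2[OF indep, of "\<lambda>i x. iexp (t \<bullet> (b i *\<^sub>R x))"]) measurable
  have int: "integrable M (?Y i)" if "i \<in> I" for i
    using that by (intro integrable_const_bound[where B=1]) auto
  have factor: "(CLINT \<omega>|M. ?Y i \<omega>) = complex_of_real (LINT x|\<mu>. cos ((b i *\<^sub>R t) \<bullet> x))" if i: "i \<in> I" for i
  proof -
    have "prob_space \<mu>" "sets \<mu> = sets borel"
      using prob_space_distr[OF X[OF i]] dist[OF i] by auto
    then have "complex_of_real (LINT x|\<mu>. cos ((b i *\<^sub>R t) \<bullet> x)) = char_vec \<mu> (b i *\<^sub>R t)"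
      using sym by (rule char_vec_symmetric[symmetric])
    also have "\<dots> = (CLINT \<omega>|M. iexp ((b i *\<^sub>R t) \<bullet> X i \<omega>))"
      unfolding char_vec_def dist[OF i, symmetric] using i by (intro integral_distr) measurable
    finally show ?thesis by (simp add: mult.commute)
  qed
  have m: "(\<lambda>\<omega>. \<Sum>i\<in>I. b i *\<^sub>R X i \<omega>) \<in> borel_measurable M"
    by (intro borel_measurable_sum borel_measurable_scaleR borel_measurable_const X)
  have i: "integrable M (\<lambda>\<omega>. iexp (t \<bullet> (\<Sum>i\<in>I. b i *\<^sub>R X i \<omega>)))"
    using m by (intro integrable_const_bound[where B=1]) auto
  have "(LINT x|distr M borel (\<lambda>\<omega>. \<Sum>i\<in>I. b i *\<^sub>R X i \<omega>). cos (t \<bullet> x)) = (LINT \<omega>|M. cos (t \<bullet> (\<Sum>i\<in>I. b i *\<^sub>R X i \<omega>)))"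
    using m by (intro integral_distr) measurable
  also have "\<dots> = Re (CLINT \<omega>|M. iexp (t \<bullet> (\<Sum>i\<in>I. b i *\<^sub>R X i \<omega>)))"
    using i by (simp add: integral_Re[symmetric] cis_conv_exp[symmetric])
  also have "(CLINT \<omega>|M. iexp (t \<bullet> (\<Sum>i\<in>I. b i *\<^sub>R X i \<omega>))) = (CLINT \<omega>|M. \<Prod>i\<in>I. ?Y i \<omega>)"
    using I by (simp add: inner_sum_right sum_distrib_left exp_sum)
  also have "\<dots> = (\<Prod>i\<in>I. CLINT \<omega>|M. ?Y i \<omega>)"
    using indep_vars_lebesgue_integral[OF I Y int] by simp
  also have "\<dots> = complex_of_real (\<Prod>i\<in>I. LINT x|\<mu>. cos ((b i *\<^sub>R t) \<bullet> x))"
    unfolding of_real_prod by (intro prod.cong refl factor)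
  finally show ?thesis by (simp only: Re_complex_of_real)
qed

theorem theorem2:
  fixes M :: "'a measure" and X :: "nat \<Rightarrow> 'a \<Rightarrow> real ^ 3" and C\<^sub>0 C\<^sub>1 :: real
    and N :: "'b measure" and \<xi> :: "'b \<Rightarrow> real ^ 3"
    and n :: nat and a :: "nat \<Rightarrow> real"
  assumes "prob_space M"
    and "prob_space.indep_vars M (\<lambda>_. borel) X {1..}"
    and "\<And>j. j \<ge> 1 \<Longrightarrow> distr M borel (X j) = distr M borel (X 1)"
    and "distr M borel (\<lambda>\<omega>. - X 1 \<omega>) = distr M borel (X 1)"
    and "C\<^sub>0 > 0"
    and "\<And>t. t \<noteq> 0 \<Longrightarrow> norm (char_vec (distr M borel (X 1)) t) \<le> C\<^sub>0 / norm t"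
    and "C\<^sub>1 = max C\<^sub>0 1"
    and "prob_space N" and "\<xi> \<in> borel_measurable N" and "distr N borel \<xi> = uniform_sphere"
    and "wasserstein2 (distr M borel (X 1)) (distr N borel \<xi>)
           \<le> ennreal (10 powi (-38) * C\<^sub>1 powi (-9)) *
              min (inverse ((\<integral>\<^sup>+ \<omega>. ennreal (norm (X 1 \<omega>) ^ 3) \<partial>M) ^ 6)) 1"
    and "n \<ge> 3"
    and "(\<Sum>j=1..n. (a j)\<^sup>2) = 1"
    and "Max ((\<lambda>j. \<bar>a j\<bar>) ` {1..n}) \<le> 1 / sqrt 2"
  shows "(\<integral>\<^sup>+ \<omega>. inverse (ennreal (norm (\<Sum>j=1..n. a j *\<^sub>R X j \<omega>))) \<partial>M)
           \<le> (\<integral>\<^sup>+ \<omega>. inverse (ennreal (norm ((X 1 \<omega> + X 2 \<omega>) /\<^sub>R sqrt 2))) \<partial>M)"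
proof -
  interpret prob_space M by fact
  define \<mu> where "\<mu> = distr M borel (X 1)"
  define \<phi> where "\<phi> t = (LINT x|\<mu>. cos (t \<bullet> x))" for t
  define f where "f t = \<bar>\<phi> t\<bar>" for t
  \<comment> \<open>Twice the constant in the hypothesis, which makes the Wasserstein inequality
    strict.\<close>
  define \<delta> :: real where "\<delta> = 2 * (10 powi (-38) * C\<^sub>1 powi (-9))"
  let ?I = "\<integral>\<^sup>+ t. ennreal ((f t)\<^sup>2) \<partial>ray_measure"
  have X [measurable]: "X j \<in> borel_measurable M" if "1 \<le> j" for j
    using assms(2) that by (auto simp: indep_vars_def)
  have \<mu>: "prob_space \<mu>" "sets \<mu> = sets borel"
    by (auto simp: \<mu>_def prob_space_distr)
  interpret mu: prob_space \<mu> by fact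
  note \<mu>(2)[measurable_cong]
  have sym: "distr \<mu> borel uminus = \<mu>"
    using assms(4) by (simp add: \<mu>_def distr_distr comp_def)
  have \<phi>_meas [measurable]: "\<phi> \<in> borel_measurable borel"
    unfolding \<phi>_def[abs_def] by measurable
  have C1: "1 \<le> C\<^sub>1" "C\<^sub>0 \<le> C\<^sub>1" using assms(7) by auto
  have powi: "C\<^sub>1 powi (-9) = 1 / C\<^sub>1 ^ 9" "(10::real) powi (-38) = 1 / 10 ^ 38"
    by (simp_all add: power_int_minus inverse_eq_divide)
  define e where "e = 1 / C\<^sub>1 ^ 9"
  have e: "0 < e" "e \<le> 1" using C1(1) by (simp_all add: e_def)
  have \<delta>_eq: "\<delta> = 2 * (1 / 10 ^ 38 * e)" by (simp add: \<delta>_def powi e_def)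
  have \<delta>: "0 < \<delta>" "\<delta> \<le> 1" using e by (simp_all add: \<delta>_eq)
  have "2 * \<delta> \<le> 1 / 10 ^ 30 * e" using e by (simp add: \<delta>_eq)
  also have "\<dots> = 1 / (10 ^ 30 * C\<^sub>1 ^ 9)" by (simp add: e_def)
  finally have \<delta>2: "2 * \<delta> \<le> 1 / (10 ^ 30 * C\<^sub>1 ^ 9)" .
  have "wasserstein2 \<mu> uniform_sphere \<le> ennreal (10 powi (-38) * C\<^sub>1 powi (-9)) * 1"
    using assms(11) unfolding \<mu>_def assms(10) by (elim order_trans) (intro mult_left_mono, auto)
  also have "\<dots> = ennreal (\<delta> / 2)"
    by (simp add: \<delta>_def)
  also have "\<dots> < ennreal \<delta>"
    using \<delta>(1) by (simp add: ennreal_less_iff)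
  finally have W: "wasserstein2 \<mu> uniform_sphere < ennreal \<delta>" .
  interpret near_sphere f C\<^sub>1 "2 * \<delta>"
  proof
    show "f \<in> borel_measurable borel" unfolding f_def[abs_def] by measurable
    show "0 \<le> f t" "f t \<le> 1" for t
      using abs_LINT_cos_le_1[OF \<mu>] by (auto simp: f_def \<phi>_def)
    show "f t \<le> C\<^sub>1 / norm t" if "t \<noteq> 0" for t
    proof -
      have "f t = norm (char_vec \<mu> t)"
        by (simp add: f_def \<phi>_def char_vec_symmetric[OF \<mu> sym])
      also have "\<dots> \<le> C\<^sub>0 / norm t" using assms(6)[OF that] by (simp add: \<mu>_def)
      also have "\<dots> \<le> C\<^sub>1 / norm t" using C1 by (intro divide_right_mono) auto
      finally show ?thesis .
    qed
    show "\<bar>f t - \<bar>sinc (norm t)\<bar>\<bar> \<le> 2 * \<delta> * (norm t)\<^sup>2" for t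
      using LINT_cos_near_sinc[OF W \<delta>(1,2), of t] unfolding f_def \<phi>_def
      by (intro order_trans[OF abs_triangle_ineq3])
  qed (use \<delta> \<delta>2 C1 in auto)
  have scale: "(\<integral>\<^sup>+ t. ennreal (f (c *\<^sub>R t) powr s) \<partial>ray_measure) = ennreal (1 / \<bar>c\<bar>) * (\<integral>\<^sup>+ t. ennreal (f t powr s) \<partial>ray_measure)"
    if "c \<noteq> 0" for c s
  proof -
    \<comment> \<open>Coefficients may be negative, while the scaling rule is for positive
      factors.\<close>
    have even: "f (- t) = f t" for t by (simp add: f_def \<phi>_def)
    have "f (c *\<^sub>R t) = f (\<bar>c\<bar> *\<^sub>R t)" for t
      using even[of "c *\<^sub>R t"] by (cases "0 \<le> c") auto
    then show ?thesis
      using nn_integral_ray_measure_scale[of "\<lambda>t. ennreal (f t powr s)" "\<bar>c\<bar>"] that by simp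
  qed
  have law: "prob_space (distr M borel (\<lambda>\<omega>. \<Sum>j\<in>J. b j *\<^sub>R X j \<omega>))"
      "(\<lambda>\<omega>. \<Sum>j\<in>J. b j *\<^sub>R X j \<omega>) \<in> borel_measurable M"
      "(LINT x|distr M borel (\<lambda>\<omega>. \<Sum>j\<in>J. b j *\<^sub>R X j \<omega>). cos (t \<bullet> x)) = (\<Prod>j\<in>J. \<phi> (b j *\<^sub>R t))"
    if J: "finite J" "J \<subseteq> {1..}" for J b t
  proof -
    show m: "(\<lambda>\<omega>. \<Sum>j\<in>J. b j *\<^sub>R X j \<omega>) \<in> borel_measurable M"
      using J by (intro borel_measurable_sum borel_measurable_scaleR borel_measurable_const X) auto
    then show "prob_space (distr M borel (\<lambda>\<omega>. \<Sum>j\<in>J. b j *\<^sub>R X j \<omega>))"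
      by (rule prob_space_distr)
    have dist: "distr M borel (X j) = \<mu>" if "j \<in> J" for j
      unfolding \<mu>_def by (rule assms(3)) (use that J in auto)
    show "(LINT x|distr M borel (\<lambda>\<omega>. \<Sum>j\<in>J. b j *\<^sub>R X j \<omega>). cos (t \<bullet> x)) = (\<Prod>j\<in>J. \<phi> (b j *\<^sub>R t))"
      unfolding \<phi>_def by (intro LINT_cos_sum_indep J(1) dist sym indep_vars_subset[OF assms(2) J(2)])
  qed
  have RHS: "(\<integral>\<^sup>+ \<omega>. inverse (ennreal (norm ((X 1 \<omega> + X 2 \<omega>) /\<^sub>R sqrt 2))) \<partial>M) = ennreal (2 / pi) * (ennreal (sqrt 2) * ?I)"
  proof -
    let ?S = "\<lambda>\<omega>. \<Sum>j\<in>{1, 2}. (1 / sqrt 2) *\<^sub>R X j \<omega>"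
    have S: "(X 1 \<omega> + X 2 \<omega>) /\<^sub>R sqrt 2 = ?S \<omega>" for \<omega>
      by (simp add: scaleR_add_right inverse_eq_divide)
    have J: "finite {1, 2::nat}" "{1, 2} \<subseteq> {1::nat..}" by auto
    \<comment> \<open>The two factors are equal, so the characteristic function is a square and the
      exact formula applies.\<close>
    have cosS: "(LINT x|distr M borel ?S. cos (t \<bullet> x)) = (f ((1 / sqrt 2) *\<^sub>R t))\<^sup>2" for t
      unfolding law(3)[OF J] by (simp add: f_def power2_eq_square)
    have "(\<integral>\<^sup>+ \<omega>. inverse (ennreal (norm (?S \<omega>))) \<partial>M) = (\<integral>\<^sup>+ x. inverse (ennreal (norm x)) \<partial>distr M borel ?S)"
      using law(2)[OF J] by (intro nn_integral_distr[symmetric]) auto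
    also have "\<dots> = ennreal (2 / pi) * (\<integral>\<^sup>+ t. ennreal ((f ((1 / sqrt 2) *\<^sub>R t))\<^sup>2) \<partial>ray_measure)"
      by (subst nn_integral_inverse_norm_eq[OF law(1)[OF J]]) (simp_all only: cosS zero_le_power2 sets_distr)
    also have "(\<integral>\<^sup>+ t. ennreal ((f ((1 / sqrt 2) *\<^sub>R t))\<^sup>2) \<partial>ray_measure) = ennreal (sqrt 2) * ?I"
      by (subst nn_integral_ray_measure_scale[of "\<lambda>t. ennreal ((f t)\<^sup>2)"]) auto
    finally show ?thesis by (simp only: S)
  qed
  let ?S = "\<lambda>\<omega>. \<Sum>j=1..n. a j *\<^sub>R X j \<omega>"
  \<comment> \<open>Zero coefficients are dropped since \<open>1 / (a j)\<^sup>2\<close> would be 0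
    for them instead of an exponent \<open>\<ge> 2\<close>.\<close>
  define J where "J = {j \<in> {1..n}. a j \<noteq> 0}"
  have J: "finite J" "J \<subseteq> {1..}" by (auto simp: J_def)
  have S: "(\<Sum>j=1..n. a j *\<^sub>R X j \<omega>) = (\<Sum>j\<in>J. a j *\<^sub>R X j \<omega>)" for \<omega>
    unfolding J_def by (intro sum.mono_neutral_right) auto
  have sumJ: "(\<Sum>j\<in>J. (a j)\<^sup>2) = 1"
    unfolding assms(13)[symmetric] J_def by (intro sum.mono_neutral_left) auto
  have small: "2 \<le> 1 / (a j)\<^sup>2" if "j \<in> J" for j
  proof -
    have "\<bar>a j\<bar> \<le> Max ((\<lambda>j. \<bar>a j\<bar>) ` {1..n})"
      using that by (intro Max_ge) (auto simp: J_def)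
    with assms(14) have "\<bar>a j\<bar>\<^sup>2 \<le> (1 / sqrt 2)\<^sup>2"
      by (intro power_mono) auto
    then show ?thesis using that by (simp add: J_def power_divide field_simps)
  qed
  have pointwise: "ennreal \<bar>\<Prod>j\<in>J. \<phi> (a j *\<^sub>R t)\<bar> \<le> (\<Sum>j\<in>J. ennreal ((a j)\<^sup>2) * ennreal (f (a j *\<^sub>R t) powr (1 / (a j)\<^sup>2)))" for t
  proof -
    \<comment> \<open>Each factor is written as a power with exponent \<open>(a j)\<^sup>2\<close>;
      these sum to 1 and are the weights for AM-GM.\<close>
    have "\<bar>\<Prod>j\<in>J. \<phi> (a j *\<^sub>R t)\<bar> = (\<Prod>j\<in>J. (f (a j *\<^sub>R t) powr (1 / (a j)\<^sup>2)) powr (a j)\<^sup>2)"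
      unfolding abs_prod by (intro prod.cong) (auto simp: J_def f_def powr_powr)
    also have "\<dots> \<le> (\<Sum>j\<in>J. (a j)\<^sup>2 * f (a j *\<^sub>R t) powr (1 / (a j)\<^sup>2))"
      using J sumJ by (intro prod_powr_le_sum) auto
    finally show ?thesis
      by (simp add: ennreal_leI ennreal_mult'[symmetric])
  qed
  have "(\<integral>\<^sup>+ \<omega>. inverse (ennreal (norm (?S \<omega>))) \<partial>M) = (\<integral>\<^sup>+ x. inverse (ennreal (norm x)) \<partial>distr M borel ?S)"
    unfolding S using law(2)[OF J] by (intro nn_integral_distr[symmetric]) auto
  also have "\<dots> \<le> ennreal (2 / pi) * (\<integral>\<^sup>+ t. ennreal \<bar>\<Prod>j\<in>J. \<phi> (a j *\<^sub>R t)\<bar> \<partial>ray_measure)"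
    using nn_integral_inverse_norm_le[OF law(1)[OF J]] unfolding S by (simp add: law(3)[OF J])
  also have "\<dots> \<le> ennreal (2 / pi) * (ennreal (sqrt 2) * ?I)"
  proof (intro mult_left_mono)
    have "(\<integral>\<^sup>+ t. ennreal \<bar>\<Prod>j\<in>J. \<phi> (a j *\<^sub>R t)\<bar> \<partial>ray_measure) \<le>
        (\<integral>\<^sup>+ t. (\<Sum>j\<in>J. ennreal ((a j)\<^sup>2) * ennreal (f (a j *\<^sub>R t) powr (1 / (a j)\<^sup>2))) \<partial>ray_measure)"
      by (intro nn_integral_mono pointwise)
    also have "\<dots> = (\<Sum>j\<in>J. ennreal ((a j)\<^sup>2) * (\<integral>\<^sup>+ t. ennreal (f (a j *\<^sub>R t) powr (1 / (a j)\<^sup>2)) \<partial>ray_measure))"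
      by (simp add: nn_integral_sum nn_integral_cmult)
    also have "\<dots> \<le> (\<Sum>j\<in>J. ennreal ((a j)\<^sup>2) * (ennreal (sqrt 2) * ?I))"
    proof (intro sum_mono mult_left_mono)
      fix j assume j: "j \<in> J"
      \<comment> \<open>The Jacobian \<open>1 / \<bar>a j\<bar>\<close> is written as
        \<open>sqrt s\<close> with \<open>s = 1 / (a j)\<^sup>2\<close>. Every summand then obeys
        the same bound, whatever the size of its coefficient, and the weights sum to 1.\<close>
      have "(\<integral>\<^sup>+ t. ennreal (f (a j *\<^sub>R t) powr (1 / (a j)\<^sup>2)) \<partial>ray_measure) =
        ennreal (sqrt (1 / (a j)\<^sup>2)) * (\<integral>\<^sup>+ t. ennreal (f t powr (1 / (a j)\<^sup>2)) \<partial>ray_measure)"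
        using j by (subst scale) (auto simp: J_def real_sqrt_divide)
      also have "\<dots> \<le> ennreal (sqrt 2) * ?I"
        using small[OF j] by (rule le_scaled_squares)
      finally show "(\<integral>\<^sup>+ t. ennreal (f (a j *\<^sub>R t) powr (1 / (a j)\<^sup>2)) \<partial>ray_measure) \<le> ennreal (sqrt 2) * ?I" .
    qed simp
    also have "\<dots> = ennreal (\<Sum>j\<in>J. (a j)\<^sup>2) * (ennreal (sqrt 2) * ?I)"
      by (simp add: sum_distrib_right flip: sum_ennreal)
    finally show "(\<integral>\<^sup>+ t. ennreal \<bar>\<Prod>j\<in>J. \<phi> (a j *\<^sub>R t)\<bar> \<partial>ray_measure) \<le> ennreal (sqrt 2) * ?I"
      by (simp add: sumJ)
  qed simp
  finally show ?thesis unfolding RHS .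
qed

end
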